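(* Let $\varphi:\mathbb B\to\mathbb B$ be a slice regular function with $\varphi(0)=0$. Then for every $f\in H^2(\mathbb B)$ the regular compositions $f^{\odot}\varphi$ and $f_{\odot}\varphi$ belong to $H^2(\mathbb B)$ and $$\|f^{\odot}\varphi\|_2\le \|f\|_2,\qquad \|f_{\odot}\varphi\|_2\le\|f\|_2 .$$
   Context: Notation: $\mathbb H$ is the quaternions, $\mathbb S=\{q\in\mathbb H:q^2=-1\}$, $\mathbb C_I=\mathbb R+I\mathbb R$ for $I\in\mathbb S$, $\mathbb B=\{q\in\mathbb H:|q|<1\}$, $B(0,R)=\{|q|<R\}$, and for $\Omega\subseteq\mathbb H$, $\Omega_I=\Omega\cap\mathbb C_I$. A function $f$ on a domain $\Omega\subseteq\mathbb H$ is (slice) regular if for every $I\in\mathbb S$ its restriction $f_I$ to $\Omega_I$ has continuous partial derivatives and $\frac12(\partial_x+I\partial_y)f_I(x+yI)=0$. A function is regular on $B(0,R)$ iff it is given there by a convergent power series $f(q)=\sum_{n\ge0}q^na_n$, $a_n\in\mathbb H$. For regular functions on a ball given by power series, the regular ($\ast$-)product is $\big(\sum q^na_n\big)\ast\big(\sum q^nb_n\big)=\sum_n q^n\sum_{k=0}^n a_kb_{n-k}$ (on general symmetric slice domains it is the unique regular extension of this slice-wise product); $\varphi^{\ast0}=1$, $\varphi^{\ast n}=\varphi\ast\varphi^{\ast(n-1)}$, and for a constant $a$, $a\ast\psi$ denotes the $\ast$-product with the constant function $a$. Regular compositions: if $f(q)=\sum_n q^na_n$ is regular on $B(0,R)$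 and $\varphi$ is regular on a symmetric slice domain with values in $B(0,R)$, then $f^{\odot}\varphi:=\sum_{n\ge0}\varphi^{\ast n}a_n$ and $f_{\odot}\varphi:=\sum_{n\ge0}a_n\ast\varphi^{\ast n}$. Hardy space: for $f$ regular on $\mathbb B$ and $0<p<\infty$, $\|f\|_p=\sup_{I\in\mathbb S}\lim_{r\to1^-}\big(\frac1{2\pi}\int_{-\pi}^{\pi}|f(re^{I\theta})|^pd\theta\big)^{1/p}$, $\|f\|_\infty=\sup_{\mathbb B}|f|$, and $H^p(\mathbb B)=\{f$ regular on $\mathbb B:\|f\|_p<\infty\}$. For $f=\sum q^na_n$, $\|f\|_2^2=\sum|a_n|^2$. *)

theory Defs
  imports "HOL-Analysis.Analysis"
begin

section \<open>Quaternions as pairs of complex numbers (Cayley-Dickson)\<close>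

text \<open>A quaternion a + b i + c j + d k is represented as the pair (z, w) with
  z = a + b i and w = c + d i, i.e. q = z + w j.  The norm of the product type
  complex \<times> complex is sqrt(|z|^2+|w|^2), the usual quaternion modulus, so
  ball 0 1 is the open unit ball of the quaternions.\<close>

type_synonym quat = "complex \<times> complex"

definition qmult :: "quat \<Rightarrow> quat \<Rightarrow> quat" where
  "qmult p q = (fst p * fst q - snd p * cnj (snd q), fst p * snd q + snd p * cnj (fst q))"

definition qone :: quat where "qone = (1, 0)"

definition qreal :: "real \<Rightarrow> quat" where "qreal x = (complex_of_real x, 0)"

primrec qpow :: "quat \<Rightarrow> nat \<Rightarrow> quat" where
  "qpow q 0 = qone"
| "qpow q (Suc n) = qmult q (qpow q n)"

text \<open>The sphere of imaginary units S = {q. q^2 = -1}.\<close>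
definition qS :: "quat set" where "qS = {q. qmult q q = - qone}"

text \<open>The point x + yI of the slice C_I.\<close>
definition slice_pt :: "quat \<Rightarrow> real \<Rightarrow> real \<Rightarrow> quat" where
  "slice_pt I x y = qreal x + y *\<^sub>R I"

section \<open>Slice regularity\<close>

text \<open>f is slice regular on the open set \<Omega> iff for every I in S the restriction
  f_I(x+yI) has continuous partial derivatives on \<Omega>_I and
  (1/2)(\<partial>_x + I \<partial>_y) f_I = 0.\<close>
definition slice_regular :: "quat set \<Rightarrow> (quat \<Rightarrow> quat) \<Rightarrow> bool" where
  "slice_regular \<Omega> f \<longleftrightarrow>
     (\<forall>I\<in>qS. \<exists>fx fy :: real \<times> real \<Rightarrow> quat.
        let U = {p. slice_pt I (fst p) (snd p) \<in> \<Omega>} in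
        (\<forall>p\<in>U. ((\<lambda>t. f (slice_pt I t (snd p))) has_vector_derivative fx p) (at (fst p)))
      \<and> (\<forall>p\<in>U. ((\<lambda>t. f (slice_pt I (fst p) t)) has_vector_derivative fy p) (at (snd p)))
      \<and> continuous_on U fx \<and> continuous_on U fy
      \<and> (\<forall>p\<in>U. (1/2) *\<^sub>R (fx p + qmult I (fy p)) = 0))"

section \<open>Hardy spaces\<close>

text \<open>\<parallel>f\<parallel>_p = sup over I of lim_{r\<rightarrow>1^-} ((1/2\<pi>) \<integral>_{-\<pi>}^{\<pi>} |f(r e^{I\<theta>})|^p d\<theta>)^{1/p},
  taken in the extended reals.\<close>
definition hardy_norm :: "real \<Rightarrow> (quat \<Rightarrow> quat) \<Rightarrow> ereal" where
  "hardy_norm p f = (SUP I\<in>qS. Lim (at_left 1)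
      (\<lambda>r. ereal ((1 / (2*pi) * integral {-pi..pi}
            (\<lambda>\<theta>. norm (f (slice_pt I (r * cos \<theta>) (r * sin \<theta>))) powr p)) powr (1/p))))"

definition H2 :: "(quat \<Rightarrow> quat) set" where
  "H2 = {f. slice_regular (ball 0 1) f \<and> hardy_norm 2 f < \<infinity>}"

section \<open>Power series, regular product and regular compositions on the unit ball\<close>

text \<open>The (unique) coefficients of the power series expansion sum q^n a_n of a
  function regular on the unit ball.\<close>
definition qcoeffs :: "(quat \<Rightarrow> quat) \<Rightarrow> nat \<Rightarrow> quat" where
  "qcoeffs f = (SOME a. \<forall>q\<in>ball 0 1. (\<lambda>n. qmult (qpow q n) (a n)) sums f q)"

definition pseries :: "(nat \<Rightarrow> quat) \<Rightarrow> quat \<Rightarrow> quat" where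
  "pseries a q = (\<Sum>n. qmult (qpow q n) (a n))"

text \<open>Coefficients of the *-product: (sum q^n a_n) * (sum q^n b_n) = sum q^n sum_k a_k b_{n-k}.\<close>
definition star_coeffs :: "(nat \<Rightarrow> quat) \<Rightarrow> (nat \<Rightarrow> quat) \<Rightarrow> nat \<Rightarrow> quat" where
  "star_coeffs a b n = (\<Sum>k\<le>n. qmult (a k) (b (n - k)))"

text \<open>Coefficients of \<phi>^{*n}; \<phi>^{*0} = 1, \<phi>^{*n} = \<phi> * \<phi>^{*(n-1)}.\<close>
primrec star_pow_coeffs :: "(nat \<Rightarrow> quat) \<Rightarrow> nat \<Rightarrow> nat \<Rightarrow> quat" where
  "star_pow_coeffs b 0 = (\<lambda>m. if m = 0 then qone else 0)"
| "star_pow_coeffs b (Suc n) = star_coeffs b (star_pow_coeffs b n)"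

definition star_pow :: "(quat \<Rightarrow> quat) \<Rightarrow> nat \<Rightarrow> quat \<Rightarrow> quat" where
  "star_pow \<phi> n = pseries (star_pow_coeffs (qcoeffs \<phi>) n)"

text \<open>f^\<odot>\<phi> = sum_n \<phi>^{*n} a_n.\<close>
definition comp_up :: "(quat \<Rightarrow> quat) \<Rightarrow> (quat \<Rightarrow> quat) \<Rightarrow> quat \<Rightarrow> quat" where
  "comp_up f \<phi> q = (\<Sum>n. qmult (star_pow \<phi> n q) (qcoeffs f n))"

text \<open>f_\<odot>\<phi> = sum_n a_n * \<phi>^{*n}, where a_n * \<psi> (constant times \<psi>) has
  coefficients a_n b'_m if \<psi> = sum q^m b'_m.\<close>
definition comp_low :: "(quat \<Rightarrow> quat) \<Rightarrow> (quat \<Rightarrow> quat) \<Rightarrow> quat \<Rightarrow> quat" where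
  "comp_low f \<phi> q =
     (\<Sum>n. pseries (\<lambda>m. qmult (qcoeffs f n) (star_pow_coeffs (qcoeffs \<phi>) n m)) q)"

end

theory Submission
  imports Defs "HOL-Complex_Analysis.Cauchy_Integral_Formula"
begin

text \<open>By Parseval on a slice, the Hardy norm of \<open>\<Sum> q\<^sup>n a\<^sub>n\<close> is the \<open>\<ell>\<^sup>2\<close> norm of \<open>a\<close>, and the
  theorem becomes a statement on coefficients.  For a polynomial \<open>g\<close> one has
  \<open>(g * \<phi>)(q) = g(q) \<phi>(g(q)\<^sup>-\<^sup>1 q g(q))\<close>, so \<open>|g * \<phi>| \<le> |g|\<close> pointwise and right multiplication by
  \<open>\<phi>\<close> is a contraction of \<open>\<ell>\<^sup>2\<close>; left multiplication is one by duality of Toeplitz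
  matrices.  With these contractions Littlewood's inductive proof of the subordination principle
  applies verbatim: \<open>f\<^sub>\<odot>\<phi>\<close> is the orthogonal sum of \<open>a\<^sub>0\<close> and \<open>(Bf)\<^sub>\<odot>\<phi> * \<phi>\<close>, where \<open>B\<close> is the
  backward shift.\<close>

section \<open>Quaternions and slices\<close>

text \<open>Noncommutativity gives each composition its side. Splitting one factor \<phi> off
  \<phi>^{*n}, away from the coefficient \<open>a n\<close>, leaves it on the right in
  \<open>comp_low\<close> and on the left in \<open>comp_up\<close>, so the induction needs right
  contraction for the former and left contraction for the latter. The pointwise bound yields only
  right contraction: where \<phi>(q) is nonzero, (\<phi> * g)(q) = \<phi>(q) g(p) with p =
  \<phi>(q)^{-1} q \<phi>(q), and p leaves the slice of q, so Parseval on that slice does not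
  control g(p). This is why duality enters. Conjugating all coefficients then exchanges the two
  sides, and one induction serves both compositions. Every estimate concerns the coefficients with
  index at most N. Coefficient n of a *-product involves only indices up to n, so such estimates
  make sense for arbitrary sequences without any convergence, and polynomials suffice to prove them.
  Because \<phi>(0) = 0, the series of \<phi>^{*n} starts at degree n, and coefficient m of a
  composition is a finite sum over n \<le> m.\<close>

definition qcnj :: "quat \<Rightarrow> quat" where
  "qcnj q = (cnj (fst q), - snd q)"

lemma norm_quat_sq: "(norm (q::quat))\<^sup>2 = (cmod (fst q))\<^sup>2 + (cmod (snd q))\<^sup>2"
  by (simp add: norm_prod_def)

lemma norm_complex_quat [simp]: "norm ((z, 0) :: quat) = cmod z"
  by (simp add: norm_prod_def)

lemma norm_qone [simp]: "norm qone = 1"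
  by (simp add: qone_def)

lemma qmult_assoc: "qmult (qmult p q) r = qmult p (qmult q r)"
  by (simp add: qmult_def algebra_simps)

text \<open>Euler's four-square identity; squared, it is polynomial in the real coordinates.\<close>

lemma norm_qmult: "norm (qmult p q) = norm p * norm q"
proof -
  have "(norm (qmult p q))\<^sup>2 = (norm p * norm q)\<^sup>2"
    unfolding norm_quat_sq power_mult_distrib cmod_power2
    by (simp add: qmult_def power2_eq_square algebra_simps)
  then show ?thesis by (simp add: power2_eq_iff_nonneg)
qed

lemma bounded_bilinear_qmult: "bounded_bilinear qmult"
proof
  show "\<exists>K. \<forall>a b. norm (qmult a b) \<le> norm a * norm b * K"
    by (intro exI[of _ 1]) (simp add: norm_qmult)
qed (auto simp: qmult_def algebra_simps scaleR_prod_def)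

interpretation qmult: bounded_bilinear qmult
  by (rule bounded_bilinear_qmult)

lemma qmult_qone [simp]: "qmult qone q = q" "qmult q qone = q"
  by (simp_all add: qmult_def qone_def)

lemma qmult_complex: "qmult (z, 0) q = (z * fst q, z * snd q)"
  by (simp add: qmult_def)

lemma qmult_qreal: "qmult (qreal x) q = x *\<^sub>R q" "qmult q (qreal x) = x *\<^sub>R q"
  by (simp_all add: qmult_def qreal_def scaleR_prod_def scaleR_conv_of_real)

lemma qmult_qcnj: "qmult q (qcnj q) = qreal ((norm q)\<^sup>2)" "qmult (qcnj q) q = qreal ((norm q)\<^sup>2)"
  unfolding norm_quat_sq
  by (simp_all add: qmult_def qcnj_def qreal_def complex_norm_square mult.commute flip: of_real_power)

lemma qcnj_cancel:
  assumes "norm u = 1"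
  shows "qmult (qcnj u) (qmult u q) = q" "qmult u (qmult (qcnj u) q) = q"
  using assms by (simp_all add: qmult_qcnj qmult_qreal flip: qmult_assoc)

lemma norm_qcnj [simp]: "norm (qcnj q) = norm q"
  by (simp add: qcnj_def norm_prod_def)

lemma norm_qpow [simp]: "norm (qpow q n) = norm q ^ n"
  by (induction n) (simp_all add: norm_qmult)

lemma qpow_add: "qpow q (m + n) = qmult (qpow q m) (qpow q n)"
  by (induction m) (simp_all add: qmult_assoc)

text \<open>Serves twice: with a rotation \<open>u\<close> it carries a slice to the complex plane,
  and with a nonzero value \<open>w\<close> of a polynomial it moves \<open>w\<close> past the
  powers of the argument.\<close>

lemma qpow_intertwine:
  assumes "qmult p u = qmult u q"
  shows "qmult (qpow p n) u = qmult u (qpow q n)"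
proof (induction n)
  case (Suc n)
  have "qmult (qpow p (Suc n)) u = qmult p (qmult u (qpow q n))"
    by (simp add: qmult_assoc Suc)
  then show ?case
    by (simp add: assms flip: qmult_assoc)
qed simp

lemma qpow_complex: "qpow (z, 0) n = (z ^ n, 0)"
  by (induction n) (simp_all add: qone_def qmult_def)

lemma mem_qS_iff: "I \<in> qS \<longleftrightarrow> Re (fst I) = 0 \<and> norm I = 1"
proof
  assume "I \<in> qS"
  then have *: "fst I * fst I - snd I * cnj (snd I) = -1" "snd I * (fst I + cnj (fst I)) = 0"
    by (auto simp: qS_def qmult_def qone_def algebra_simps prod_eq_iff)
  have re: "Re (fst I) = 0"
  proof (cases "snd I = 0")
    case True
    with * have "fst I ^ 2 = \<i> ^ 2" by (simp add: power2_eq_square)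
    then have "fst I = \<i> \<or> fst I = -\<i>" by (simp only: power2_eq_iff)
    then show ?thesis by auto
  next
    case False
    with *(2) have "fst I + cnj (fst I) = 0" by simp
    then show ?thesis by (simp add: complex_eq_iff)
  qed
  have "(norm I)\<^sup>2 = 1"
    using *(1) re unfolding norm_quat_sq cmod_power2 by (simp add: complex_eq_iff power2_eq_square)
  then show "Re (fst I) = 0 \<and> norm I = 1"
    using re norm_ge_zero[of I] by (auto simp: power2_eq_1_iff)
next
  assume I: "Re (fst I) = 0 \<and> norm I = 1"
  then have "(norm I)\<^sup>2 = 1" by simp
  with I show "I \<in> qS"
    unfolding norm_quat_sq cmod_power2
    by (simp add: qS_def qmult_def qone_def prod_eq_iff complex_eq_iff power2_eq_square)
qed

text \<open>Since \<open>u = 1 - I i\<close> satisfies \<open>I u = u i\<close>, it rotates the slice of \<open>i\<close> to that of \<open>I\<close>,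
  except that it vanishes for \<open>I = -i\<close>.\<close>

lemma qS_rotation:
  assumes "I \<in> qS"
  obtains u where "norm u = 1" "qmult I u = qmult u (\<i>, 0)"
proof (cases "I = (-\<i>, 0)")
  case True
  \<comment> \<open>\<open>(0, 1)\<close> is the unit j, which anticommutes with \<i>.\<close>
  show ?thesis
    by (rule that[of "(0, 1)"]) (simp_all add: True qmult_def norm_prod_def)
next
  case False
  define v where "v = qone - qmult I (\<i>, 0)"
  have sq: "qmult I I = - qone" using assms by (simp add: qS_def)
  have ii: "qmult (\<i>, 0) (\<i>, 0) = - qone" by (simp add: qmult_def qone_def)
  have "qmult I v = I + (\<i>, 0)"
    by (simp add: v_def qmult.diff_right sq qmult.minus_left flip: qmult_assoc)
  moreover have "qmult v (\<i>, 0) = I + (\<i>, 0)"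
    by (simp add: v_def qmult.diff_left ii qmult.minus_right qmult_assoc)
  moreover have "v \<noteq> 0"
  proof
    assume "v = 0"
    with \<open>qmult I v = I + (\<i>, 0)\<close> have "I + (\<i>, 0) = 0" by (simp add: qmult.zero_right)
    with False show False by (simp add: prod_eq_iff add_eq_0_iff2)
  qed
  ultimately show ?thesis
    by (intro that[of "(1 / norm v) *\<^sub>R v"]) (simp_all add: qmult.scaleR_left qmult.scaleR_right)
qed

lemma slice_pt_rotation:
  assumes "qmult I u = qmult u (\<i>, 0)"
  shows "qmult (slice_pt I x y) u = qmult u (Complex x y, 0)"
proof -
  have eq: "(Complex x y, 0) = qreal x + y *\<^sub>R (\<i>, 0)"
    by (simp add: qreal_def complex_eq_iff)
  show ?thesis
    by (simp only: eq slice_pt_def qmult.add_left qmult.add_right qmult_qreal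
        qmult.scaleR_left qmult.scaleR_right assms)
qed

lemma norm_slice_pt:
  assumes "I \<in> qS"
  shows "norm (slice_pt I x y) = cmod (Complex x y)"
proof -
  obtain u where "norm u = 1" "qmult I u = qmult u (\<i>, 0)"
    using qS_rotation[OF assms] by blast
  with slice_pt_rotation[of I u x y] show ?thesis
    by (metis norm_qmult mult_1 mult.right_neutral norm_complex_quat)
qed

lemma ex_slice_pt:
  obtains I x y where "I \<in> qS" "q = slice_pt I x y"
proof -
  define v where "v = q - qreal (Re (fst q))"
  have rev: "Re (fst v) = 0" by (simp add: v_def qreal_def)
  show ?thesis
  proof (cases "v = 0")
    \<comment> \<open>A real point lies in every slice, so the unit \<i> is an arbitrary
      choice.\<close>
    case True
    then show ?thesis
      by (intro that[of "(\<i>, 0)" "Re (fst q)" 0])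
        (simp_all add: v_def slice_pt_def mem_qS_iff del: scaleR_Pair)
  next
    case False
    then show ?thesis
      by (intro that[of "(1 / norm v) *\<^sub>R v" "Re (fst q)" "norm v"])
        (auto simp: slice_pt_def mem_qS_iff rev, simp add: v_def)
  qed
qed

section \<open>Slice regular functions and power series\<close>

lemma sums_quat_iff:
  fixes f :: "nat \<Rightarrow> quat"
  shows "f sums s \<longleftrightarrow> (\<lambda>n. fst (f n)) sums fst s \<and> (\<lambda>n. snd (f n)) sums snd s"
proof
  assume "f sums s"
  then show "(\<lambda>n. fst (f n)) sums fst s \<and> (\<lambda>n. snd (f n)) sums snd s"
    using bounded_linear.sums[OF bounded_linear_fst] bounded_linear.sums[OF bounded_linear_snd] by blast
next
  assume "(\<lambda>n. fst (f n)) sums fst s \<and> (\<lambda>n. snd (f n)) sums snd s"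
  then have "(\<lambda>n. (\<Sum>i<n. fst (f i), \<Sum>i<n. snd (f i))) \<longlonglongrightarrow> (fst s, snd s)"
    unfolding sums_def by (intro tendsto_Pair) auto
  moreover have "(\<Sum>i<n. fst (f i), \<Sum>i<n. snd (f i)) = sum f {..<n}" for n
    by (simp add: prod_eq_iff fst_sum snd_sum)
  ultimately show "f sums s"
    by (simp add: sums_def)
qed

section \<open>Splitting a quaternionic series on a slice into two complex power series\<close>

lemma qmult_qcnj_intertwine:
  assumes "norm u = 1" "qmult p u = qmult u q"
  shows "qmult (qcnj u) (qmult p x) = qmult q (qmult (qcnj u) x)"
proof -
  have "qmult (qcnj u) (qmult p x) = qmult (qcnj u) (qmult (qmult p u) (qmult (qcnj u) x))"
    by (simp add: qmult_assoc qcnj_cancel assms(1))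
  then show ?thesis
    by (simp add: assms qmult_assoc qcnj_cancel)
qed

text \<open>Left multiplication by the inverse \<open>qcnj u\<close> turns q^n \<open>a n\<close>
  into z^n (\<open>qcnj u\<close> \<open>a n\<close>), and a complex number on the left acts on both
  components as a scalar. This reduces every question on one slice to complex analysis.\<close>

lemma rotated_series_sums_iff:
  assumes "norm u = 1" "qmult q u = qmult u (z, 0)"
  shows "(\<lambda>n. qmult (qpow q n) (a n)) sums s \<longleftrightarrow>
    (\<lambda>n. fst (qmult (qcnj u) (a n)) * z ^ n) sums fst (qmult (qcnj u) s) \<and>
    (\<lambda>n. snd (qmult (qcnj u) (a n)) * z ^ n) sums snd (qmult (qcnj u) s)"
proof -
  have *: "qmult (qcnj u) (qmult (qpow q n) (a n)) = qmult (z ^ n, 0) (qmult (qcnj u) (a n))" for n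
    using qmult_qcnj_intertwine[OF assms(1), of "qpow q n" "(z ^ n, 0)" "a n"]
      qpow_intertwine[OF assms(2), of n] by (simp add: qpow_complex)
  have "(\<lambda>n. qmult (qpow q n) (a n)) sums s \<longleftrightarrow>
    (\<lambda>n. qmult (qcnj u) (qmult (qpow q n) (a n))) sums qmult (qcnj u) s" (is "?L \<longleftrightarrow> ?R")
  proof
    show "?L \<Longrightarrow> ?R" by (rule qmult.bounded_linear_right[THEN bounded_linear.sums])
    assume ?R
    then have "(\<lambda>n. qmult u (qmult (qcnj u) (qmult (qpow q n) (a n)))) sums qmult u (qmult (qcnj u) s)"
      by (rule qmult.bounded_linear_right[THEN bounded_linear.sums])
    then show ?L by (simp add: qcnj_cancel assms(1))
  qed
  then show ?thesis
    unfolding * qmult_complex sums_quat_iff by (simp add: mult.commute)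
qed

lemma has_derivative_continuous_partials:
  fixes h :: "real \<Rightarrow> real \<Rightarrow> 'a::real_normed_vector"
  assumes "open U" "p \<in> U"
    and dx: "((\<lambda>t. h t (snd p)) has_vector_derivative dx) (at (fst p))"
    and dy: "\<And>p. p \<in> U \<Longrightarrow> ((\<lambda>t. h (fst p) t) has_vector_derivative hy p) (at (snd p))"
    and cont: "continuous_on U hy"
  shows "((\<lambda>p. h (fst p) (snd p)) has_derivative (\<lambda>d. fst d *\<^sub>R dx + snd d *\<^sub>R hy p)) (at p)"
proof -
  obtain X Y where XY: "open X" "open Y" "p \<in> X \<times> Y" "X \<times> Y \<subseteq> U"
    using open_prod_elim[OF assms(1,2)] by blast
  \<comment> \<open>The criterion by partial derivatives wants a convex set in the second variable,
    hence a ball inside \<open>Y\<close>.\<close>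
  then obtain e where e: "e > 0" "ball (snd p) e \<subseteq> Y"
    by (auto simp: open_contains_ball)
  let ?S = "X \<times> ball (snd p) e"
  have S: "open ?S" "p \<in> ?S" "?S \<subseteq> U"
    using XY e by (auto intro!: open_Times simp: mem_Times_iff)
  let ?D = "\<lambda>(tx, ty). tx *\<^sub>R dx + blinfun_apply (blinfun_scaleR_left (hy (fst p, snd p))) ty"
  have "((\<lambda>(x, y). h x y) has_derivative ?D) (at (fst p, snd p) within ?S)"
  proof (rule has_derivative_partialsI)
    show "((\<lambda>x. h x (snd p)) has_derivative (\<lambda>tx. tx *\<^sub>R dx)) (at (fst p) within X)"
      using dx by (simp add: has_vector_derivative_def has_derivative_at_withinI)
    show "((\<lambda>y. h x y) has_derivative blinfun_apply (blinfun_scaleR_left (hy (x, y))))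
        (at y within ball (snd p) e)" if "x \<in> X" "y \<in> ball (snd p) e" for x y
    proof -
      have "(x, y) \<in> U" using that S(3) by blast
      from dy[OF this] show ?thesis
        by (simp add: has_vector_derivative_def has_derivative_at_withinI)
    qed
    have "continuous (at p within ?S) hy"
      using continuous_on_subset[OF cont S(3)] S(2)
      unfolding continuous_on_eq_continuous_within by blast
    moreover have "(\<lambda>(x, y). blinfun_scaleR_left (hy (x, y))) = (\<lambda>p. blinfun_scaleR_left (hy p))"
      by (auto simp: fun_eq_iff)
    ultimately show "continuous (at (fst p, snd p) within ?S) (\<lambda>(x, y). blinfun_scaleR_left (hy (x, y)))"
      by (simp add: bounded_linear.continuous[OF bounded_linear_blinfun_scaleR_left])
  qed (use e in auto)
  then show ?thesis
    using at_within_open[OF S(2,1)] by (simp add: case_prod_unfold)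
qed

text \<open>Since \<open>I\<close> u = u \<i>, multiplying by \<open>qcnj u\<close> turns the
  operator with \<open>I\<close> into the usual one with \<i>. So F_y = \<i> F_x, and the real
  derivative of \<open>F\<close> is complex linear in both components.\<close>

lemma slice_cauchy_riemann:
  assumes f: "slice_regular (ball 0 1) f" and I: "I \<in> qS"
    and u: "norm u = 1" "qmult I u = qmult u (\<i>, 0)"
  defines "F \<equiv> \<lambda>z. qmult (qcnj u) (f (slice_pt I (Re z) (Im z)))"
  assumes z: "cmod z < 1"
  shows "\<exists>d. (F has_derivative (\<lambda>w. (w * fst d, w * snd d))) (at z)"
proof -
  define U where "U = {p. slice_pt I (fst p) (snd p) \<in> ball 0 1}"
  obtain fx fy where
    fx: "\<And>p. p \<in> U \<Longrightarrow> ((\<lambda>t. f (slice_pt I t (snd p))) has_vector_derivative fx p) (at (fst p))" and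
    fy: "\<And>p. p \<in> U \<Longrightarrow> ((\<lambda>t. f (slice_pt I (fst p) t)) has_vector_derivative fy p) (at (snd p))" and
    cont: "continuous_on U fx" "continuous_on U fy" and
    cr: "\<And>p. p \<in> U \<Longrightarrow> (1/2) *\<^sub>R (fx p + qmult I (fy p)) = 0"
    using f I unfolding slice_regular_def U_def Let_def by blast
  have U_eq: "U = {p. cmod (Complex (fst p) (snd p)) < 1}"
    by (simp add: U_def norm_slice_pt[OF I])
  have "open U"
    unfolding U_eq Complex_eq by (intro open_Collect_less continuous_intros)
  define p where "p = (Re z, Im z)"
  have "p \<in> U" using z by (simp add: U_eq p_def)
  define d where "d = qmult (qcnj u) (fx p)"
  have "fx p = - qmult I (fy p)"
    using cr[OF \<open>p \<in> U\<close>] by (simp add: add_eq_0_iff2)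
  then have "d = - qmult (\<i>, 0) (qmult (qcnj u) (fy p))"
    by (simp add: d_def qmult.minus_right qmult_qcnj_intertwine[OF u])
  then have dy: "qmult (qcnj u) (fy p) = qmult (\<i>, 0) d"
    by (simp add: qmult.minus_right qmult_complex flip: mult.assoc)
  have 1: "((\<lambda>p. f (slice_pt I (fst p) (snd p))) has_derivative
      (\<lambda>d. fst d *\<^sub>R fx p + snd d *\<^sub>R fy p)) (at p)"
    by (rule has_derivative_continuous_partials[OF \<open>open U\<close> \<open>p \<in> U\<close> fx[OF \<open>p \<in> U\<close>] fy cont(2)])
  have 2: "((\<lambda>z. (Re z, Im z)) has_derivative (\<lambda>z. (Re z, Im z))) (at z)"
    by (intro derivative_intros has_derivative_ident)
  have "((\<lambda>z. f (slice_pt I (Re z) (Im z))) has_derivative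
      (\<lambda>w. Re w *\<^sub>R fx p + Im w *\<^sub>R fy p)) (at z)"
    using has_derivative_compose[OF 2 1[unfolded p_def]] by (simp add: p_def)
  then have "(F has_derivative (\<lambda>w. qmult (qcnj u) (Re w *\<^sub>R fx p + Im w *\<^sub>R fy p))) (at z)"
    unfolding F_def by (rule bounded_linear.has_derivative[OF qmult.bounded_linear_right])
  moreover have "qmult (qcnj u) (Re w *\<^sub>R fx p + Im w *\<^sub>R fy p) = (w * fst d, w * snd d)" for w
  proof -
    have "qmult (qcnj u) (Re w *\<^sub>R fx p + Im w *\<^sub>R fy p) = Re w *\<^sub>R d + Im w *\<^sub>R qmult (\<i>, 0) d"
      by (simp add: qmult.add_right qmult.scaleR_right dy d_def)
    also have "\<dots> = (w * fst d, w * snd d)"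
      by (simp add: prod_eq_iff qmult_complex complex_eq_iff)
    finally show ?thesis .
  qed
  ultimately show ?thesis by auto
qed

text \<open>Both components of the rotated function are holomorphic on the disc; \<open>u\<close>
  carries their Taylor coefficients back. At this stage the coefficients may depend on
  \<open>I\<close>.\<close>

lemma slice_expansion:
  assumes f: "slice_regular (ball 0 1) f" and I: "I \<in> qS"
  obtains a where "\<And>x y. cmod (Complex x y) < 1 \<Longrightarrow>
    (\<lambda>n. qmult (qpow (slice_pt I x y) n) (a n)) sums f (slice_pt I x y)"
proof -
  obtain u where u: "norm u = 1" "qmult I u = qmult u (\<i>, 0)"
    using qS_rotation[OF I] by blast
  define F where "F = (\<lambda>z. qmult (qcnj u) (f (slice_pt I (Re z) (Im z))))"
  have "\<exists>d. (F has_derivative (\<lambda>w. (w * fst d, w * snd d))) (at z)" if "cmod z < 1" for z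
    unfolding F_def by (rule slice_cauchy_riemann[OF f I u that])
  then obtain d where d: "\<And>z. cmod z < 1 \<Longrightarrow>
      (F has_derivative (\<lambda>w. (w * fst (d z), w * snd (d z)))) (at z)"
    by metis
  have "((\<lambda>z. fst (F z)) has_field_derivative fst (d z)) (at z)"
    "((\<lambda>z. snd (F z)) has_field_derivative snd (d z)) (at z)" if "cmod z < 1" for z
    using has_derivative_fst[OF d[OF that]] has_derivative_snd[OF d[OF that]]
    by (simp_all add: has_field_derivative_def mult.commute[of _ "fst _"] mult.commute[of _ "snd _"])
  then have hol: "(\<lambda>z. fst (F z)) holomorphic_on ball 0 1" "(\<lambda>z. snd (F z)) holomorphic_on ball 0 1"
    by (metis (no_types, lifting) holomorphic_on_open open_ball mem_ball_0)+
  define c where "c n = ((deriv ^^ n) (\<lambda>z. fst (F z)) 0 / fact n, (deriv ^^ n) (\<lambda>z. snd (F z)) 0 / fact n)" for n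
  show ?thesis
  proof (rule that[of "\<lambda>n. qmult u (c n)"])
    fix x y assume xy: "cmod (Complex x y) < 1"
    show "(\<lambda>n. qmult (qpow (slice_pt I x y) n) (qmult u (c n))) sums f (slice_pt I x y)"
      unfolding rotated_series_sums_iff[OF u(1) slice_pt_rotation[OF u(2)]] qcnj_cancel[OF u(1)]
      using holomorphic_power_series[OF hol(1), of "Complex x y"]
        holomorphic_power_series[OF hol(2), of "Complex x y"] xy
      by (simp add: c_def F_def)
  qed
qed

section \<open>Independence of the coefficients from the slice\<close>

lemma real_powser_eq_0:
  fixes d :: "nat \<Rightarrow> real"
  assumes "\<And>x. \<bar>x\<bar> < 1 \<Longrightarrow> (\<lambda>n. d n * x ^ n) sums 0"
  shows "d n = 0"
proof (rule ccontr)
  assume "d n \<noteq> 0"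
  \<comment> \<open>Isolation of zeros is applied with a nonzero coefficient of positive index, so
    index 0 is settled separately.\<close>
  have "d 0 = 0"
    using sums_unique2[OF powser_sums_zero[of d] assms[of 0]] by simp
  with \<open>d n \<noteq> 0\<close> have "n > 0" by (cases n) auto
  show False
  proof (rule powser_0_nonzero[of 1 0 d "\<lambda>_. 0" n])
    fix s :: real assume "s > 0" and s: "\<And>z::real. z \<in> cball 0 s - {0} \<Longrightarrow> (0::real) \<noteq> 0"
    with s[of s] show False by simp
  qed (use assms \<open>d n \<noteq> 0\<close> \<open>n > 0\<close> in auto)
qed

lemma real_powser_unique:
  fixes a b :: "nat \<Rightarrow> 'a::euclidean_space"
  assumes "\<And>x. \<bar>x\<bar> < 1 \<Longrightarrow> (\<lambda>n. x ^ n *\<^sub>R a n) sums s x"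
    and "\<And>x. \<bar>x\<bar> < 1 \<Longrightarrow> (\<lambda>n. x ^ n *\<^sub>R b n) sums s x"
  shows "a = b"
proof
  fix n
  have "inner (a n - b n) i = 0" if "i \<in> Basis" for i
  proof (rule real_powser_eq_0[of "\<lambda>n. inner (a n - b n) i"])
    fix x :: real assume x: "\<bar>x\<bar> < 1"
    have "(\<lambda>n. inner (x ^ n *\<^sub>R a n - x ^ n *\<^sub>R b n) i) sums inner (s x - s x) i"
      by (intro bounded_linear.sums[OF bounded_linear_inner_left] sums_diff assms x)
    then show "(\<lambda>n. inner (a n - b n) i * x ^ n) sums 0"
      by (simp add: algebra_simps)
  qed
  then have "a n - b n = 0"
    by (rule euclidean_all_zero_iff[THEN iffD1, OF ballI])
  then show "a n = b n" by (rule eq_iff_diff_eq_0[THEN iffD2])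
qed

lemma qpow_qreal: "qpow (qreal x) n = qreal (x ^ n)"
  by (simp add: qreal_def qpow_complex)

text \<open>The property by which \<open>qcoeffs\<close> is chosen, stated for any \<open>a\<close>
  so that series can be handled without the choice operator.\<close>

definition has_qseries :: "(quat \<Rightarrow> quat) \<Rightarrow> (nat \<Rightarrow> quat) \<Rightarrow> bool" where
  "has_qseries f a \<longleftrightarrow> (\<forall>q\<in>ball 0 1. (\<lambda>n. qmult (qpow q n) (a n)) sums f q)"

lemma has_qseriesD:
  "has_qseries f a \<Longrightarrow> q \<in> ball 0 1 \<Longrightarrow> (\<lambda>n. qmult (qpow q n) (a n)) sums f q"
  by (simp add: has_qseries_def)

text \<open>All slices share the real axis, and a power series is determined by its values there;
  hence the coefficients found on different slices coincide.\<close>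

lemma slice_regular_expansion:
  assumes f: "slice_regular (ball 0 1) f"
  shows "\<exists>a. has_qseries f a"
proof -
  have "\<forall>I\<in>qS. \<exists>a. \<forall>x y. cmod (Complex x y) < 1 \<longrightarrow>
      (\<lambda>n. qmult (qpow (slice_pt I x y) n) (a n)) sums f (slice_pt I x y)"
  proof
    fix I :: quat assume "I \<in> qS"
    then show "\<exists>a. \<forall>x y. cmod (Complex x y) < 1 \<longrightarrow>
        (\<lambda>n. qmult (qpow (slice_pt I x y) n) (a n)) sums f (slice_pt I x y)"
      by (rule slice_expansion[OF f]) blast
  qed
  then obtain a where "\<forall>I\<in>qS. \<forall>x y. cmod (Complex x y) < 1 \<longrightarrow>
      (\<lambda>n. qmult (qpow (slice_pt I x y) n) (a I n)) sums f (slice_pt I x y)"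
    unfolding bchoice_iff by blast
  then have a: "\<And>I x y. I \<in> qS \<Longrightarrow> cmod (Complex x y) < 1 \<Longrightarrow>
      (\<lambda>n. qmult (qpow (slice_pt I x y) n) (a I n)) sums f (slice_pt I x y)"
    by blast
  have real: "(\<lambda>n. x ^ n *\<^sub>R a I n) sums f (qreal x)" if "I \<in> qS" "\<bar>x\<bar> < 1" for I x
    using a[OF that(1), of x 0] that(2)
    by (simp add: slice_pt_def qpow_qreal qmult_qreal complex_norm del: scaleR_Pair)
  have i: "(\<i>, 0) \<in> qS" by (simp add: mem_qS_iff)
  have indep: "a I = a (\<i>, 0)" if "I \<in> qS" for I
    by (rule real_powser_unique[OF real[OF that] real[OF i]])
  show ?thesis
    unfolding has_qseries_def
  proof (intro exI ballI)
    fix q :: quat assume q: "q \<in> ball 0 1"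
    obtain I x y where I: "I \<in> qS" "q = slice_pt I x y" by (rule ex_slice_pt)
    have "cmod (Complex x y) < 1"
      using q by (simp add: I norm_slice_pt[OF I(1)])
    from a[OF I(1) this] show "(\<lambda>n. qmult (qpow q n) (a (\<i>, 0) n)) sums f q"
      unfolding I(2) indep[OF I(1)] .
  qed
qed

text \<open>The converse direction, by the same splitting; it is what makes the compositions regular
  once they are known to be power series.\<close>

lemma has_qseries_slice_regular:
  assumes f: "has_qseries f a"
  shows "slice_regular (ball 0 1) f"
  unfolding slice_regular_def Let_def
proof
  fix I assume I: "I \<in> qS"
  obtain u where u: "norm u = 1" "qmult I u = qmult u (\<i>, 0)"
    using qS_rotation[OF I] by blast
  define F where "F z = qmult (qcnj u) (f (slice_pt I (Re z) (Im z)))" for z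
  define F1 F2 where "F1 z = fst (F z)" and "F2 z = snd (F z)" for z
  have "(\<lambda>n. fst (qmult (qcnj u) (a n)) * z ^ n) sums F1 z"
    "(\<lambda>n. snd (qmult (qcnj u) (a n)) * z ^ n) sums F2 z" if "cmod z < 1" for z
  proof -
    have "slice_pt I (Re z) (Im z) \<in> ball 0 1"
      using that by (simp add: norm_slice_pt[OF I])
    from has_qseriesD[OF f this, unfolded rotated_series_sums_iff[OF u(1) slice_pt_rotation[OF u(2)]]]
    show "(\<lambda>n. fst (qmult (qcnj u) (a n)) * z ^ n) sums F1 z"
      "(\<lambda>n. snd (qmult (qcnj u) (a n)) * z ^ n) sums F2 z"
      by (simp_all add: F1_def F2_def F_def)
  qed
  then have hol: "F1 holomorphic_on ball 0 1" "F2 holomorphic_on ball 0 1"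
    by (auto intro!: power_series_holomorphic)
  then have deriv: "(F1 has_field_derivative deriv F1 z) (at z)"
      "(F2 has_field_derivative deriv F2 z) (at z)" if "cmod z < 1" for z
    using that by (auto intro!: holomorphic_derivI)
  have f_eq: "f (slice_pt I x y) = qmult u (F1 (Complex x y), F2 (Complex x y))" for x y
    by (simp add: F1_def F2_def F_def qcnj_cancel[OF u(1)])
  define z :: "real \<times> real \<Rightarrow> complex" where "z p = Complex (fst p) (snd p)" for p
  define fx where "fx p = qmult u (deriv F1 (z p), deriv F2 (z p))" for p
  \<comment> \<open>The y-derivative of a holomorphic function is \<i> times its derivative;
    \<open>I\<close> u = u \<i> supplies the second \<i> that makes \<open>fx\<close> and
    \<open>qmult I fy\<close> cancel.\<close>
  define fy where "fy p = qmult u (\<i> * deriv F1 (z p), \<i> * deriv F2 (z p))" for p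
  let ?U = "{p. slice_pt I (fst p) (snd p) \<in> ball 0 1}"
  have U: "p \<in> ?U \<longleftrightarrow> cmod (z p) < 1" for p
    by (simp add: norm_slice_pt[OF I] z_def)
  have dx: "((\<lambda>t. Complex t y) has_vector_derivative 1) (at x)" for x y
    unfolding Complex_eq by (auto intro!: derivative_eq_intros)
  have dy: "((\<lambda>t. Complex x t) has_vector_derivative \<i>) (at y)" for x y
    unfolding Complex_eq by (auto intro!: derivative_eq_intros)
  have "((\<lambda>t. f (slice_pt I t (snd p))) has_vector_derivative fx p) (at (fst p))" if "p \<in> ?U" for p
  proof -
    note d = deriv[of "z p", unfolded z_def, OF that[unfolded U z_def]]
    show ?thesis
      unfolding f_eq fx_def z_def
      using field_vector_diff_chain_at[OF dx d(1)] field_vector_diff_chain_at[OF dx d(2)]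
      by (intro bounded_linear.has_vector_derivative[OF qmult.bounded_linear_right]
          has_vector_derivative_Pair) (simp_all add: o_def)
  qed
  moreover have "((\<lambda>t. f (slice_pt I (fst p) t)) has_vector_derivative fy p) (at (snd p))" if "p \<in> ?U" for p
  proof -
    note d = deriv[of "z p", unfolded z_def, OF that[unfolded U z_def]]
    show ?thesis
      unfolding f_eq fy_def z_def
      using field_vector_diff_chain_at[OF dy d(1)] field_vector_diff_chain_at[OF dy d(2)]
      by (intro bounded_linear.has_vector_derivative[OF qmult.bounded_linear_right]
          has_vector_derivative_Pair) (simp_all add: o_def)
  qed
  moreover have "continuous_on ?U (\<lambda>p. deriv F1 (z p))" "continuous_on ?U (\<lambda>p. deriv F2 (z p))"
  proof -
    have "continuous_on ?U z"
      unfolding z_def Complex_eq by (intro continuous_intros)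
    moreover have "z ` ?U \<subseteq> ball 0 1" by (intro image_subsetI) (drule U[THEN iffD1], simp)
    ultimately show "continuous_on ?U (\<lambda>p. deriv F1 (z p))" "continuous_on ?U (\<lambda>p. deriv F2 (z p))"
      using hol[THEN holomorphic_deriv, THEN holomorphic_on_imp_continuous_on]
      by (auto intro: continuous_on_compose2)
  qed
  then have "continuous_on ?U fx \<and> continuous_on ?U fy"
    unfolding fx_def fy_def
    by (intro conjI bounded_linear.continuous_on[OF qmult.bounded_linear_right] continuous_intros)
  moreover have "(1/2) *\<^sub>R (fx p + qmult I (fy p)) = 0" for p
  proof -
    have "qmult I (fy p) = qmult (qmult u (\<i>, 0)) (\<i> * deriv F1 (z p), \<i> * deriv F2 (z p))"
      by (simp add: fy_def u(2) flip: qmult_assoc)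
    also have "\<dots> = qmult u (- (deriv F1 (z p), deriv F2 (z p)))"
      by (simp add: qmult_assoc qmult_complex flip: mult.assoc)
    finally show ?thesis
      by (simp only: fx_def qmult.minus_right) simp
  qed
  ultimately show "\<exists>fx fy. (\<forall>p\<in>?U. ((\<lambda>t. f (slice_pt I t (snd p))) has_vector_derivative fx p) (at (fst p)))
      \<and> (\<forall>p\<in>?U. ((\<lambda>t. f (slice_pt I (fst p) t)) has_vector_derivative fy p) (at (snd p)))
      \<and> continuous_on ?U fx \<and> continuous_on ?U fy
      \<and> (\<forall>p\<in>?U. (1/2) *\<^sub>R (fx p + qmult I (fy p)) = 0)"
    by blast
qed

section \<open>Parseval and the Hardy norm\<close>

lemma has_integral_cis_int:
  "((\<lambda>\<theta>. cis (real_of_int k * \<theta>)) has_integral (if k = 0 then 2 * pi else 0)) {-pi..pi}"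
proof (cases "k = 0")
  case True
  then show ?thesis
    using has_integral_const_real[of "1::complex" "-pi" pi] by (simp add: scaleR_conv_of_real)
next
  case False
  let ?g = "\<lambda>z. exp (\<i> * of_int k * z) / (\<i> * of_int k)"
  have "((\<lambda>\<theta>. exp (\<i> * of_int k * complex_of_real \<theta>)) has_integral
      ?g (of_real pi) - ?g (of_real (-pi))) {-pi..pi}"
  proof (rule fundamental_theorem_of_calculus)
    fix x
    have "(?g has_field_derivative exp (\<i> * of_int k * of_real x)) (at (of_real x))"
      using False by (auto intro!: derivative_eq_intros simp: field_simps)
    then show "((\<lambda>x. ?g (of_real x)) has_vector_derivative exp (\<i> * of_int k * complex_of_real x))
        (at x within {- pi..pi})"
      by (rule has_vector_derivative_real_field)
  qed simp
  moreover have ex: "exp (\<i> * of_int k * complex_of_real x) = cis (real_of_int k * x)" for x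
    by (simp add: cis_conv_exp mult.assoc)
  moreover have "cis (real_of_int k * pi) = cis (real_of_int k * (-pi))"
    by (simp add: complex_eq_iff mult.commute)
  then have "?g (of_real pi) - ?g (of_real (-pi)) = 0"
    unfolding ex by simp
  ultimately show ?thesis
    using False by (simp only: if_False of_real_0)
qed

text \<open>Expanding the square as a double sum, orthogonality of the characters leaves the
  diagonal.\<close>

lemma has_integral_norm_trig_poly:
  fixes c :: "nat \<Rightarrow> complex"
  shows "((\<lambda>\<theta>. (cmod (\<Sum>n<N. c n * cis (real n * \<theta>)))\<^sup>2) has_integral
    (2 * pi * (\<Sum>n<N. (cmod (c n))\<^sup>2))) {-pi..pi}"
proof -
  have eq: "complex_of_real ((cmod (\<Sum>n<N. c n * cis (real n * \<theta>)))\<^sup>2) =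
      (\<Sum>n<N. \<Sum>m<N. c n * cnj (c m) * cis (real_of_int (int n - int m) * \<theta>))" for \<theta>
    unfolding complex_norm_square cnj_sum sum_product
  proof (intro sum.cong refl)
    fix n m
    have "cis (real_of_int (int n - int m) * \<theta>) = cis (real n * \<theta>) * cnj (cis (real m * \<theta>))"
      by (simp add: cis_mult cis_cnj algebra_simps)
    then show "c n * cis (real n * \<theta>) * cnj (c m * cis (real m * \<theta>)) =
        c n * cnj (c m) * cis (real_of_int (int n - int m) * \<theta>)"
      by (simp add: algebra_simps)
  qed
  have "((\<lambda>\<theta>. complex_of_real ((cmod (\<Sum>n<N. c n * cis (real n * \<theta>)))\<^sup>2)) has_integral
     (\<Sum>n<N. \<Sum>m<N. c n * cnj (c m) * (if int n - int m = 0 then 2 * pi else 0))) {-pi..pi}"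
    unfolding eq
    by (intro has_integral_sum has_integral_mult_right has_integral_cis_int) simp_all
  moreover have "(\<Sum>n<N. \<Sum>m<N. c n * cnj (c m) * (if int n - int m = 0 then 2 * pi else 0)) =
      complex_of_real (2 * pi * (\<Sum>n<N. (cmod (c n))\<^sup>2))"
  proof -
    have "(\<Sum>m<N. c n * cnj (c m) * (if int n - int m = 0 then 2 * pi else 0)) =
        complex_of_real (2 * pi * (cmod (c n))\<^sup>2)" if "n < N" for n
    proof -
      have "(\<Sum>m<N. c n * cnj (c m) * (if int n - int m = 0 then 2 * pi else 0)) =
          (\<Sum>m<N. if n = m then c n * cnj (c n) * (2 * pi) else 0)"
        by (intro sum.cong) auto
      also have "\<dots> = c n * cnj (c n) * (2 * pi)"
        using that by simp
      finally show ?thesis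
        by (simp add: complex_norm_square[symmetric] mult_ac)
    qed
    then show ?thesis by (simp add: sum_distrib_left)
  qed
  ultimately have "((\<lambda>\<theta>. complex_of_real ((cmod (\<Sum>n<N. c n * cis (real n * \<theta>)))\<^sup>2)) has_integral
     complex_of_real (2 * pi * (\<Sum>n<N. (cmod (c n))\<^sup>2))) {-pi..pi}"
    by simp
  from has_integral_linear[OF this bounded_linear_Re] show ?thesis
    unfolding o_def Re_complex_of_real .
qed

lemma complex_parseval:
  fixes c :: "nat \<Rightarrow> complex"
  assumes F: "\<forall>z. cmod z < 1 \<longrightarrow> (\<lambda>n. c n * z ^ n) sums F z"
    and r: "0 \<le> r" "r < 1"
  shows "(\<lambda>\<theta>. (cmod (F (rcis r \<theta>)))\<^sup>2) integrable_on {-pi..pi}"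
    and "(\<lambda>n. (cmod (c n))\<^sup>2 * r ^ (2 * n)) sums
      (1 / (2 * pi) * integral {-pi..pi} (\<lambda>\<theta>. (cmod (F (rcis r \<theta>)))\<^sup>2))"
proof -
  \<comment> \<open>Convergence at a larger radius gives absolute convergence at \<open>r\<close>,
    hence the constant \<open>B\<close> that dominates all partial sums.\<close>
  obtain s where s: "r < s" "s < 1" using r dense by blast
  have "summable (\<lambda>n. norm (c n * complex_of_real r ^ n))"
    by (rule powser_insidea[OF sums_summable[OF F[rule_format, of "of_real s"]]]) (use r s in auto)
  then have M: "summable (\<lambda>n. cmod (c n) * r ^ n)"
    using r by (simp add: norm_mult norm_power)
  let ?P = "\<lambda>k \<theta>. \<Sum>n<k. c n * rcis r \<theta> ^ n"
  define B where "B = (\<Sum>n. cmod (c n) * r ^ n)"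
  have le: "cmod (?P k \<theta>) \<le> B" for k \<theta>
  proof -
    have "cmod (?P k \<theta>) \<le> (\<Sum>n<k. cmod (c n * rcis r \<theta> ^ n))" by (rule norm_sum)
    also have "\<dots> = (\<Sum>n<k. cmod (c n) * r ^ n)"
      using r by (simp add: norm_mult norm_power)
    also have "\<dots> \<le> B"
      unfolding B_def by (rule sum_le_suminf[OF M]) (use r in auto)
    finally show ?thesis .
  qed
  have P: "((\<lambda>\<theta>. (cmod (?P k \<theta>))\<^sup>2) has_integral
      (2 * pi * (\<Sum>n<k. (cmod (c n))\<^sup>2 * r ^ (2 * n)))) {-pi..pi}" for k
  proof -
    have "c n * rcis r \<theta> ^ n = c n * of_real (r ^ n) * cis (real n * \<theta>)" for n \<theta>
      unfolding DeMoivre2 unfolding rcis_def by (simp add: mult.assoc)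
    moreover have "(cmod (c n))\<^sup>2 * r ^ (2 * n) = (cmod (c n * of_real (r ^ n)))\<^sup>2" for n
      using r by (simp add: norm_mult norm_power power_mult_distrib power_even_eq)
    ultimately show ?thesis
      using has_integral_norm_trig_poly[where N = k and c = "\<lambda>n. c n * of_real (r ^ n)"] by (simp only:)
  qed
  have conv: "(\<lambda>k. (cmod (?P k \<theta>))\<^sup>2) \<longlonglongrightarrow> (cmod (F (rcis r \<theta>)))\<^sup>2" for \<theta>
    using F[rule_format, of "rcis r \<theta>"] r unfolding sums_def by (intro tendsto_intros) simp
  have int: "(\<lambda>\<theta>. (cmod (?P k \<theta>))\<^sup>2) integrable_on {-pi..pi}" for k
    using P[of k] by blast
  have bound: "norm ((cmod (?P k \<theta>))\<^sup>2) \<le> B\<^sup>2" for k \<theta>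
    using le[of \<theta> k] by (simp add: power_mono)
  note dc = dominated_convergence[OF int integrable_const_ivl bound conv]
  show "(\<lambda>\<theta>. (cmod (F (rcis r \<theta>)))\<^sup>2) integrable_on {-pi..pi}"
    by (rule dc)
  have "(\<lambda>k. 1 / (2 * pi) * integral {-pi..pi} (\<lambda>\<theta>. (cmod (?P k \<theta>))\<^sup>2)) \<longlonglongrightarrow>
      1 / (2 * pi) * integral {-pi..pi} (\<lambda>\<theta>. (cmod (F (rcis r \<theta>)))\<^sup>2)"
    by (intro tendsto_intros dc)
  then show "(\<lambda>n. (cmod (c n))\<^sup>2 * r ^ (2 * n)) sums
      (1 / (2 * pi) * integral {-pi..pi} (\<lambda>\<theta>. (cmod (F (rcis r \<theta>)))\<^sup>2))"
    unfolding sums_def integral_unique[OF P] by simp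
qed

text \<open>Complex Parseval for the two components of the rotated function; as |u| = 1, their
  squared moduli add up to those of \<open>f\<close> and of \<open>a n\<close>.\<close>

lemma quat_parseval:
  assumes f: "has_qseries f a"
    and I: "I \<in> qS" and r: "0 \<le> r" "r < 1"
  shows "(\<lambda>\<theta>. (norm (f (slice_pt I (r * cos \<theta>) (r * sin \<theta>))))\<^sup>2) integrable_on {-pi..pi}"
    and "(\<lambda>n. (norm (a n))\<^sup>2 * r ^ (2 * n)) sums
      (1 / (2 * pi) * integral {-pi..pi} (\<lambda>\<theta>. (norm (f (slice_pt I (r * cos \<theta>) (r * sin \<theta>))))\<^sup>2))"
proof -
  obtain u where u: "norm u = 1" "qmult I u = qmult u (\<i>, 0)"
    using qS_rotation[OF I] by blast
  define F where "F z = qmult (qcnj u) (f (slice_pt I (Re z) (Im z)))" for z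
  have "(\<lambda>n. fst (qmult (qcnj u) (a n)) * z ^ n) sums fst (F z)"
    "(\<lambda>n. snd (qmult (qcnj u) (a n)) * z ^ n) sums snd (F z)" if "cmod z < 1" for z
  proof -
    have "slice_pt I (Re z) (Im z) \<in> ball 0 1"
      using that by (simp add: norm_slice_pt[OF I])
    from has_qseriesD[OF f this, unfolded rotated_series_sums_iff[OF u(1) slice_pt_rotation[OF u(2)]]]
    show "(\<lambda>n. fst (qmult (qcnj u) (a n)) * z ^ n) sums fst (F z)"
      "(\<lambda>n. snd (qmult (qcnj u) (a n)) * z ^ n) sums snd (F z)"
      by (simp_all add: F_def)
  qed
  then have F: "\<forall>z. cmod z < 1 \<longrightarrow> (\<lambda>n. fst (qmult (qcnj u) (a n)) * z ^ n) sums fst (F z)"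
    "\<forall>z. cmod z < 1 \<longrightarrow> (\<lambda>n. snd (qmult (qcnj u) (a n)) * z ^ n) sums snd (F z)"
    by blast+
  note p1 = complex_parseval[OF F(1) r] and p2 = complex_parseval[OF F(2) r]
  have nf: "(cmod (fst (F (rcis r \<theta>))))\<^sup>2 + (cmod (snd (F (rcis r \<theta>))))\<^sup>2 =
      (norm (f (slice_pt I (r * cos \<theta>) (r * sin \<theta>))))\<^sup>2" for \<theta>
    by (simp add: F_def norm_qmult u(1) flip: norm_quat_sq)
  have na: "(cmod (fst (qmult (qcnj u) (a n))))\<^sup>2 + (cmod (snd (qmult (qcnj u) (a n))))\<^sup>2 = (norm (a n))\<^sup>2" for n
    by (simp add: norm_qmult u(1) flip: norm_quat_sq)
  show "(\<lambda>\<theta>. (norm (f (slice_pt I (r * cos \<theta>) (r * sin \<theta>))))\<^sup>2) integrable_on {-pi..pi}"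
    using integrable_add[OF p1(1) p2(1)] unfolding nf .
  show "(\<lambda>n. (norm (a n))\<^sup>2 * r ^ (2 * n)) sums
      (1 / (2 * pi) * integral {-pi..pi} (\<lambda>\<theta>. (norm (f (slice_pt I (r * cos \<theta>) (r * sin \<theta>))))\<^sup>2))"
    using sums_add[OF p1(2) p2(2)]
    unfolding distrib_right[symmetric] distrib_left[symmetric] na
      integral_add[OF p1(1) p2(1), symmetric] nf .
qed

text \<open>By Parseval the mean is the same on every slice, so the supremum over \<open>I\<close>
  is that of a constant, and it increases with r. A supremum in \<open>ereal\<close> also covers
  infinite norm, so that membership in \<open>H2\<close> can be derived from this formula.\<close>

lemma hardy_norm_2_eq:
  assumes f: "has_qseries f a"
  shows "hardy_norm 2 f = (SUP N. ereal (sqrt (\<Sum>n\<le>N. (norm (a n))\<^sup>2)))" (is "_ = ?L")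
proof -
  have "Lim (at_left 1) (\<lambda>r. ereal ((1 / (2*pi) * integral {-pi..pi}
          (\<lambda>\<theta>. norm (f (slice_pt I (r * cos \<theta>) (r * sin \<theta>))) powr 2)) powr (1/2))) = ?L"
    (is "Lim _ ?M = _") if I: "I \<in> qS" for I
  proof (rule tendsto_Lim)
    have M: "?M r = ereal (sqrt (\<Sum>n. (norm (a n))\<^sup>2 * r ^ (2 * n)))"
      "summable (\<lambda>n. (norm (a n))\<^sup>2 * r ^ (2 * n))" if "r \<in> {0<..<1}" for r
    proof -
      from that have "0 \<le> r" "r < 1" by auto
      note p = quat_parseval(2)[OF f I this]
      have "0 \<le> (\<Sum>n. (norm (a n))\<^sup>2 * r ^ (2 * n))"
        by (rule suminf_nonneg[OF sums_summable[OF p]]) (use that in auto)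
      then show "?M r = ereal (sqrt (\<Sum>n. (norm (a n))\<^sup>2 * r ^ (2 * n)))"
        by (simp only: powr_numeral norm_ge_zero powr_half_sqrt sums_unique[OF p])
      show "summable (\<lambda>n. (norm (a n))\<^sup>2 * r ^ (2 * n))"
        by (rule sums_summable[OF p])
    qed
    have ev: "\<forall>\<^sub>F r in at_left 1. r \<in> {0<..<1::real}"
      by (rule eventually_at_left_real) simp
    show "(?M \<longlongrightarrow> ?L) (at_left 1)"
    proof (rule increasing_tendsto)
      show "\<forall>\<^sub>F r in at_left 1. ?M r \<le> ?L"
        using ev
      proof eventually_elim
        fix r :: real assume r: "r \<in> {0<..<1}"
        have "(\<lambda>N. ereal (sqrt (\<Sum>n\<le>N. (norm (a n))\<^sup>2 * r ^ (2 * n)))) \<longlonglongrightarrow> ?M r"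
          unfolding M(1)[OF r] using summable_LIMSEQ'[OF M(2)[OF r]] by (intro tendsto_intros)
        then show "?M r \<le> ?L"
        proof (rule LIMSEQ_le_const2, intro exI allI impI)
          fix N
          have "(\<Sum>n\<le>N. (norm (a n))\<^sup>2 * r ^ (2 * n)) \<le> (\<Sum>n\<le>N. (norm (a n))\<^sup>2)"
            using r by (intro sum_mono mult_left_le power_le_one) auto
          then show "ereal (sqrt (\<Sum>n\<le>N. (norm (a n))\<^sup>2 * r ^ (2 * n))) \<le> ?L"
            by (intro SUP_upper2[of N]) auto
        qed
      qed
    next
      \<comment> \<open>Finitely many terms already exceed \<open>x\<close>, and a finite sum is
        continuous at r = 1.\<close>
      fix x assume "x < ?L"
      then obtain N where "x < ereal (sqrt (\<Sum>n\<le>N. (norm (a n))\<^sup>2))"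
        by (auto simp: less_SUP_iff)
      moreover have "((\<lambda>r. ereal (sqrt (\<Sum>n\<le>N. (norm (a n))\<^sup>2 * r ^ (2 * n)))) \<longlongrightarrow>
          ereal (sqrt (\<Sum>n\<le>N. (norm (a n))\<^sup>2 * 1 ^ (2 * n)))) (at_left 1)"
        by (intro tendsto_intros)
      ultimately have "\<forall>\<^sub>F r in at_left 1. x < ereal (sqrt (\<Sum>n\<le>N. (norm (a n))\<^sup>2 * r ^ (2 * n)))"
        by (intro order_tendstoD(1)) auto
      then show "\<forall>\<^sub>F r in at_left 1. x < ?M r"
        using ev
      proof eventually_elim
        fix r :: real
        assume "x < ereal (sqrt (\<Sum>n\<le>N. (norm (a n))\<^sup>2 * r ^ (2 * n)))" and r: "r \<in> {0<..<1}"
        moreover have "(\<Sum>n\<le>N. (norm (a n))\<^sup>2 * r ^ (2 * n)) \<le> (\<Sum>n. (norm (a n))\<^sup>2 * r ^ (2 * n))"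
          by (rule sum_le_suminf[OF M(2)[OF r]]) (use r in auto)
        ultimately show "x < ?M r"
          unfolding M(1)[OF r] by (meson ereal_less_eq(3) less_le_trans real_sqrt_le_mono)
      qed
    qed
  qed simp
  moreover have "(\<i>, 0) \<in> qS" by (simp add: mem_qS_iff)
  ultimately show ?thesis
    unfolding hardy_norm_def by (auto intro!: SUP_eq_const)
qed

section \<open>Multiplication by a self-map of the ball\<close>

lemma qcnj_qmult: "qcnj (qmult p q) = qmult (qcnj q) (qcnj p)"
  by (simp add: qcnj_def qmult_def algebra_simps)

lemma qcnj_sum: "qcnj (sum f A) = (\<Sum>x\<in>A. qcnj (f x))"
  by (simp add: qcnj_def prod_eq_iff fst_sum snd_sum sum_negf)

lemma qcnj_qcnj [simp]: "qcnj (qcnj q) = q"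
  by (simp add: qcnj_def)

lemma qcnj_0 [simp]: "qcnj 0 = 0"
  by (simp add: qcnj_def zero_prod_def)

text \<open>The adjoint of left multiplication by \<open>b\<close> for the real inner
  product.\<close>

lemma inner_qmult_right: "inner c (qmult b a) = inner (qmult (qcnj b) c) a"
  by (simp add: inner_prod_def inner_complex_def qmult_def qcnj_def algebra_simps)

text \<open>Since \<open>q w = w p\<close> with \<open>p = w\<^sup>-\<^sup>1 q w\<close>, a factor \<open>w\<close> between the powers of \<open>q\<close> and the
  coefficients can be moved to the front at the cost of moving the argument inside its sphere.\<close>

lemma sandwiched_series:
  assumes \<phi>: "has_qseries \<phi> b" and q: "q \<in> ball 0 1"
  shows "\<exists>p\<in>ball 0 1. (\<lambda>l. qmult (qpow q l) (qmult w (b l))) sums qmult w (\<phi> p)"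
proof (cases "w = 0")
  case True
  with q show ?thesis
    by (intro bexI[of _ q]) (simp_all add: qmult.zero_left qmult.zero_right)
next
  case False
  define p where "p = (1 / (norm w)\<^sup>2) *\<^sub>R qmult (qcnj w) (qmult q w)"
  have qw: "qmult q w = qmult w p"
    using False by (simp add: p_def qmult.scaleR_left qmult.scaleR_right qmult_qcnj qmult_qreal flip: qmult_assoc)
  then have "norm q * norm w = norm w * norm p"
    by (metis norm_qmult)
  with False q have p: "p \<in> ball 0 1" by simp
  have "qmult (qpow q l) (qmult w (b l)) = qmult w (qmult (qpow p l) (b l))" for l
    by (simp add: qpow_intertwine[OF qw] flip: qmult_assoc)
  then have "(\<lambda>l. qmult (qpow q l) (qmult w (b l))) sums qmult w (\<phi> p)"
    using bounded_linear.sums[OF qmult.bounded_linear_right has_qseriesD[OF \<phi> p]] by simp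
  with p show ?thesis by blast
qed

text \<open>Powers of q commute, so q^(k+l) \<open>a k\<close> \<open>b l\<close> = q^l (q^k
  \<open>a k\<close>) \<open>b l\<close>. Summing over the finitely many k puts the value of the
  polynomial between q^l and \<open>b l\<close>, where \<open>sandwiched_series\<close>
  applies.\<close>

lemma star_polynomial_series:
  assumes \<phi>: "has_qseries \<phi> b" and q: "q \<in> ball 0 1" and a: "\<And>k. k > N \<Longrightarrow> a k = 0"
  shows "\<exists>p\<in>ball 0 1. (\<lambda>n. qmult (qpow q n) (star_coeffs a b n)) sums
           qmult (\<Sum>k\<le>N. qmult (qpow q k) (a k)) (\<phi> p)"
proof -
  define w where "w k = qmult (qpow q k) (a k)" for k
  define W where "W = (\<Sum>k\<le>N. w k)"
  obtain p where p: "p \<in> ball 0 1" "(\<lambda>l. qmult (qpow q l) (qmult W (b l))) sums qmult W (\<phi> p)"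
    using sandwiched_series[OF \<phi> q, of W] by blast
  have "\<forall>k. \<exists>s. (\<lambda>l. qmult (qpow q l) (qmult (w k) (b l))) sums s"
    using sandwiched_series[OF \<phi> q] by blast
  then obtain s where s: "\<And>k. (\<lambda>l. qmult (qpow q l) (qmult (w k) (b l))) sums s k"
    by metis
  have "(\<lambda>l. \<Sum>k\<le>N. qmult (qpow q l) (qmult (w k) (b l))) sums (\<Sum>k\<le>N. s k)"
    by (intro sums_sum s)
  then have sum_s: "(\<Sum>k\<le>N. s k) = qmult W (\<phi> p)"
    using p(2) unfolding W_def qmult.sum_left qmult.sum_right by (rule sums_unique2)
  \<comment> \<open>The k-th series delayed by k places, so that the *-product becomes a termwise
    sum.\<close>
  define t where "t k n = (if n < k then 0 else qmult (qpow q n) (qmult (a k) (b (n - k))))" for k n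
  have t: "t k sums s k" for k
  proof -
    have "t k (n + k) = qmult (qpow q n) (qmult (w k) (b n))" for n
      by (simp add: t_def w_def qpow_add qmult_assoc)
    then have "t k sums (s k + (\<Sum>n<k. t k n))"
      using s[of k] sums_iff_shift[of "t k" k "s k"] by simp
    then show ?thesis by (simp add: t_def)
  qed
  have "(\<lambda>n. \<Sum>k\<le>N. t k n) sums (\<Sum>k\<le>N. s k)"
    by (intro sums_sum t)
  moreover have "(\<Sum>k\<le>N. t k n) = qmult (qpow q n) (star_coeffs a b n)" for n
  proof -
    \<comment> \<open>Beyond \<open>N\<close> the coefficients of \<open>a\<close> vanish, beyond
      \<open>n\<close> the delay does; \<open>max n N\<close> is a common range.\<close>
    have "(\<Sum>k\<le>N. t k n) = (\<Sum>k\<le>max n N. t k n)"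
      by (rule sum.mono_neutral_left)
        (auto simp: t_def a qmult.zero_left qmult.zero_right)
    also have "\<dots> = (\<Sum>k\<le>n. t k n)"
      by (rule sum.mono_neutral_right) (auto simp: t_def)
    also have "\<dots> = (\<Sum>k\<le>n. qmult (qpow q n) (qmult (a k) (b (n - k))))"
      by (intro sum.cong) (auto simp: t_def)
    finally show ?thesis by (simp add: star_coeffs_def qmult.sum_right)
  qed
  ultimately show ?thesis
    using p(1) unfolding sum_s W_def w_def by auto
qed

text \<open>Cutting \<open>a\<close> off after \<open>N\<close> does not change the first
  coefficients of the product and makes the left factor a polynomial. The pointwise bound is
  integrated over circles of one slice, and r tends to 1.\<close>

lemma star_right_contraction:
  assumes \<phi>: "has_qseries \<phi> b" "\<phi> ` ball 0 1 \<subseteq> ball 0 1"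
  shows "(\<Sum>n\<le>N. (norm (star_coeffs a b n))\<^sup>2) \<le> (\<Sum>n\<le>N. (norm (a n))\<^sup>2)"
proof -
  define a' where "a' k = (if k \<le> N then a k else 0)" for k
  have star: "star_coeffs a' b n = star_coeffs a b n" if "n \<le> N" for n
    using that by (auto simp: star_coeffs_def a'_def intro!: sum.cong)
  define A where "A q = (\<Sum>k\<le>N. qmult (qpow q k) (a' k))" for q
  have A: "has_qseries A a'"
    unfolding has_qseries_def A_def
    by (intro ballI sums_finite) (auto simp: a'_def qmult.zero_right)
  \<comment> \<open>The point \<open>p\<close> varies with \<open>q\<close>, but only |\<phi> p|
    \<le> 1 matters. The guarded existential allows the sums to be collected into one function
    \<open>G\<close>.\<close>
  have "\<forall>q. \<exists>s. q \<in> ball 0 1 \<longrightarrow>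
      (\<lambda>n. qmult (qpow q n) (star_coeffs a' b n)) sums s \<and> norm s \<le> norm (A q)"
  proof
    fix q :: quat
    show "\<exists>s. q \<in> ball 0 1 \<longrightarrow>
      (\<lambda>n. qmult (qpow q n) (star_coeffs a' b n)) sums s \<and> norm s \<le> norm (A q)"
    proof (cases "q \<in> ball 0 1")
      case True
      obtain p where p: "p \<in> ball 0 1"
        "(\<lambda>n. qmult (qpow q n) (star_coeffs a' b n)) sums qmult (A q) (\<phi> p)"
        using star_polynomial_series[OF \<phi>(1) True, of N a'] by (auto simp: a'_def A_def)
      have "norm (\<phi> p) \<le> 1" using p(1) \<phi>(2) by force
      then have "norm (qmult (A q) (\<phi> p)) \<le> norm (A q)"
        by (simp add: norm_qmult mult_left_le)
      with p(2) show ?thesis by blast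
    qed blast
  qed
  then obtain G where G: "\<And>q. q \<in> ball 0 1 \<Longrightarrow>
      (\<lambda>n. qmult (qpow q n) (star_coeffs a' b n)) sums G q \<and> norm (G q) \<le> norm (A q)"
    by metis
  then have Gs: "has_qseries G (star_coeffs a' b)"
    by (simp add: has_qseries_def)
  have I: "(\<i>, 0) \<in> qS" by (simp add: mem_qS_iff)
  have le: "(\<Sum>n\<le>N. (norm (star_coeffs a b n))\<^sup>2 * r ^ (2 * n)) \<le> (\<Sum>n\<le>N. (norm (a n))\<^sup>2)"
    if r: "0 < r" "r < 1" for r
  proof -
    let ?z = "\<lambda>\<theta>. slice_pt (\<i>, 0) (r * cos \<theta>) (r * sin \<theta>)"
    from r have r0: "0 \<le> r" by simp
    note pG = quat_parseval[OF Gs I r0 r(2)] and pA = quat_parseval[OF A I r0 r(2)]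
    have "?z \<theta> \<in> ball 0 1" for \<theta>
    proof -
      have "Complex (r * cos \<theta>) (r * sin \<theta>) = rcis r \<theta>"
        by (simp add: complex_eq_iff)
      with r show ?thesis by (simp add: norm_slice_pt[OF I] del: scaleR_Pair)
    qed
    then have "integral {-pi..pi} (\<lambda>\<theta>. (norm (G (?z \<theta>)))\<^sup>2) \<le> integral {-pi..pi} (\<lambda>\<theta>. (norm (A (?z \<theta>)))\<^sup>2)"
      using G by (intro integral_le pG pA power_mono) auto
    then have *: "(\<Sum>n. (norm (star_coeffs a' b n))\<^sup>2 * r ^ (2 * n)) \<le> (\<Sum>n. (norm (a' n))\<^sup>2 * r ^ (2 * n))"
      unfolding sums_unique[OF pG(2), symmetric] sums_unique[OF pA(2), symmetric]
      by (intro mult_left_mono) auto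
    have "(\<Sum>n\<le>N. (norm (star_coeffs a b n))\<^sup>2 * r ^ (2 * n)) =
        (\<Sum>n\<le>N. (norm (star_coeffs a' b n))\<^sup>2 * r ^ (2 * n))"
      by (simp add: star)
    also have "\<dots> \<le> (\<Sum>n. (norm (star_coeffs a' b n))\<^sup>2 * r ^ (2 * n))"
      by (rule sum_le_suminf[OF sums_summable[OF pG(2)]]) (use r in auto)
    also note *
    also have "(\<Sum>n. (norm (a' n))\<^sup>2 * r ^ (2 * n)) = (\<Sum>n\<le>N. (norm (a' n))\<^sup>2 * r ^ (2 * n))"
      by (rule suminf_finite) (auto simp: a'_def)
    also have "\<dots> \<le> (\<Sum>n\<le>N. (norm (a n))\<^sup>2)"
      using r by (intro sum_mono) (auto simp: a'_def intro!: mult_left_le power_le_one)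
    finally show ?thesis .
  qed
  have lim: "((\<lambda>r. \<Sum>n\<le>N. (norm (star_coeffs a b n))\<^sup>2 * r ^ (2 * n)) \<longlongrightarrow>
      (\<Sum>n\<le>N. (norm (star_coeffs a b n))\<^sup>2 * 1 ^ (2 * n))) (at_left 1)"
    by (intro tendsto_intros)
  have "\<forall>\<^sub>F r in at_left 1. r \<in> {0<..<1::real}"
    by (rule eventually_at_left_real) simp
  then have "\<forall>\<^sub>F r in at_left 1.
      (\<Sum>n\<le>N. (norm (star_coeffs a b n))\<^sup>2 * r ^ (2 * n)) \<le> (\<Sum>n\<le>N. (norm (a n))\<^sup>2)"
    by eventually_elim (auto intro: le)
  from tendsto_upperbound[OF lim this] show ?thesis by simp
qed

text \<open>The truncated Toeplitz matrix \<open>(b (n - m))\<close> of left multiplication by \<open>b\<close> becomes that of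
  right multiplication by \<open>b\<close> after taking the adjoint, conjugating and reversing the index order,
  so one is a contraction iff the other is.\<close>

lemma star_left_contraction:
  assumes contr: "\<And>x. (\<Sum>n\<le>N. (norm (star_coeffs x b n))\<^sup>2) \<le> (\<Sum>n\<le>N. (norm (x n))\<^sup>2)"
  shows "(\<Sum>n\<le>N. (norm (star_coeffs b a n))\<^sup>2) \<le> (\<Sum>n\<le>N. (norm (a n))\<^sup>2)"
proof -
  define c where "c = star_coeffs b a"
  define C where "C = (\<Sum>n\<le>N. (norm (c n))\<^sup>2)"
  define d where "d j = qcnj (c (N - j))" for j
  \<comment> \<open>The adjoint matrix applied to \<open>c\<close>, so that the inner product of
    \<open>c\<close> with \<open>star_coeffs b a\<close> equals that of \<open>e\<close> with
    \<open>a\<close>.\<close>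
  define e where "e m = (\<Sum>n\<le>N. if m \<le> n then qmult (qcnj (b (n - m))) (c n) else 0)" for m
  have c_eq: "c n = (\<Sum>m\<le>N. if m \<le> n then qmult (b (n - m)) (a m) else 0)" if "n \<le> N" for n
  proof -
    have "c n = (\<Sum>m\<le>n. qmult (b (n - m)) (a m))"
      unfolding c_def star_coeffs_def
      by (rule sum.reindex_bij_witness[of _ "\<lambda>m. n - m" "\<lambda>m. n - m"]) auto
    also have "\<dots> = (\<Sum>m\<le>n. if m \<le> n then qmult (b (n - m)) (a m) else 0)"
      by (intro sum.cong) auto
    also have "\<dots> = (\<Sum>m\<le>N. if m \<le> n then qmult (b (n - m)) (a m) else 0)"
      by (rule sum.mono_neutral_left) (use that in auto)
    finally show ?thesis .
  qed
  have e_eq: "norm (e m) = norm (star_coeffs d b (N - m))" if "m \<le> N" for m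
  proof -
    have "qcnj (e m) = (\<Sum>n\<le>N. if m \<le> n then qmult (qcnj (c n)) (b (n - m)) else 0)"
      unfolding e_def qcnj_sum by (intro sum.cong) (auto simp: qcnj_qmult)
    also have "\<dots> = (\<Sum>n\<in>{m..N}. qmult (qcnj (c n)) (b (n - m)))"
      by (rule sum.mono_neutral_cong_right) auto
    also have "\<dots> = star_coeffs d b (N - m)"
      unfolding star_coeffs_def d_def
      by (rule sum.reindex_bij_witness[of _ "\<lambda>j. N - j" "\<lambda>n. N - n"])
        (use that in \<open>auto simp: algebra_simps\<close>)
    finally show ?thesis by (metis norm_qcnj)
  qed
  have rev: "(\<Sum>m\<le>N. g (N - m)) = (\<Sum>m\<le>N. g m)" for g :: "nat \<Rightarrow> real"
    by (rule sum.reindex_bij_witness[of _ "\<lambda>m. N - m" "\<lambda>m. N - m"]) auto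
  have E: "(\<Sum>m\<le>N. (norm (e m))\<^sup>2) \<le> C"
  proof -
    have "(\<Sum>m\<le>N. (norm (e m))\<^sup>2) = (\<Sum>m\<le>N. (norm (star_coeffs d b (N - m)))\<^sup>2)"
      by (simp add: e_eq)
    also have "\<dots> = (\<Sum>m\<le>N. (norm (star_coeffs d b m))\<^sup>2)"
      by (rule rev)
    also have "\<dots> \<le> (\<Sum>m\<le>N. (norm (d m))\<^sup>2)"
      by (rule contr)
    also have "\<dots> = C"
      unfolding C_def d_def norm_qcnj by (rule rev)
    finally show ?thesis .
  qed
  have "C = (\<Sum>n\<le>N. \<Sum>m\<le>N. if m \<le> n then inner (c n) (qmult (b (n - m)) (a m)) else 0)"
    unfolding C_def power2_norm_eq_inner
  proof (intro sum.cong refl)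
    fix n assume "n \<in> {..N}"
    then have "inner (c n) (c n) =
        inner (c n) (\<Sum>m\<le>N. if m \<le> n then qmult (b (n - m)) (a m) else 0)"
      using c_eq[of n] by simp
    then show "inner (c n) (c n) =
        (\<Sum>m\<le>N. if m \<le> n then inner (c n) (qmult (b (n - m)) (a m)) else 0)"
      by (simp add: inner_sum_right if_distrib[of "inner (c n)"] cong: if_cong)
  qed
  also have "\<dots> = (\<Sum>m\<le>N. \<Sum>n\<le>N. if m \<le> n then inner (c n) (qmult (b (n - m)) (a m)) else 0)"
    by (rule sum.swap)
  also have "\<dots> = (\<Sum>m\<le>N. inner (e m) (a m))"
    by (simp add: e_def inner_sum_left inner_qmult_right if_distrib[of "\<lambda>x. inner x _"] cong: if_cong)
  also have "\<dots> \<le> (\<Sum>m\<le>N. norm (e m) * norm (a m))"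
    by (intro sum_mono norm_cauchy_schwarz)
  \<comment> \<open>\<open>C\<close> is now bounded by the pairing of \<open>e\<close> and
    \<open>a\<close>; Cauchy-Schwarz and \<open>E\<close> give a factor \<open>C\<close> on both
    sides, cancelled unless it is 0.\<close>
  finally have "C\<^sup>2 \<le> (\<Sum>m\<le>N. norm (e m) * norm (a m))\<^sup>2"
    by (intro power_mono) (simp_all add: C_def sum_nonneg)
  also have "\<dots> \<le> (\<Sum>m\<le>N. (norm (e m))\<^sup>2) * (\<Sum>m\<le>N. (norm (a m))\<^sup>2)"
    by (rule Cauchy_Schwarz_ineq_sum)
  also have "\<dots> \<le> C * (\<Sum>m\<le>N. (norm (a m))\<^sup>2)"
    by (intro mult_right_mono E sum_nonneg) simp
  finally have "C * C \<le> C * (\<Sum>m\<le>N. (norm (a m))\<^sup>2)"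
    by (simp add: power2_eq_square)
  moreover have "C \<ge> 0" "(\<Sum>m\<le>N. (norm (a m))\<^sup>2) \<ge> 0"
    by (simp_all add: C_def sum_nonneg)
  ultimately have "C \<le> (\<Sum>m\<le>N. (norm (a m))\<^sup>2)"
    by (cases "C = 0") (auto simp: mult_le_cancel_left)
  then show ?thesis by (simp add: C_def c_def)
qed

section \<open>Star powers and the subordination principle\<close>

text \<open>The reindexing of the triangle used for formal power series concerns only addition, so
  it holds for noncommuting coefficients.\<close>

lemma star_coeffs_assoc:
  "star_coeffs (star_coeffs a b) c = star_coeffs a (star_coeffs b c)"
proof
  fix n
  have "star_coeffs (star_coeffs a b) c n =
      (\<Sum>k=0..n. \<Sum>j=0..k. qmult (a j) (qmult (b (k - j)) (c (n - k))))"
    by (simp add: star_coeffs_def qmult.sum_left qmult_assoc atLeast0AtMost)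
  also have "\<dots> = (\<Sum>j=0..n. \<Sum>i=0..n - j. qmult (a j) (qmult (b i) (c (n - j - i))))"
    by (rule fps_mult_assoc_lemma)
  finally show "star_coeffs (star_coeffs a b) c n = star_coeffs a (star_coeffs b c) n"
    by (simp add: star_coeffs_def qmult.sum_right atLeast0AtMost)
qed

lemma star_coeffs_one:
  "star_coeffs a (\<lambda>m. if m = 0 then qone else 0) = a"
  "star_coeffs (\<lambda>m. if m = 0 then qone else 0) a = a"
proof -
  have "star_coeffs a (\<lambda>m. if m = 0 then qone else 0) n = (\<Sum>k\<le>n. if k = n then a k else 0)" for n
    unfolding star_coeffs_def by (intro sum.cong) (auto simp: qmult.zero_right)
  then show "star_coeffs a (\<lambda>m. if m = 0 then qone else 0) = a"
    by (simp add: fun_eq_iff)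
  have "star_coeffs (\<lambda>m. if m = 0 then qone else 0) a n = (\<Sum>k\<le>n. if k = 0 then a n else 0)" for n
    unfolding star_coeffs_def by (intro sum.cong) (auto simp: qmult.zero_left)
  then show "star_coeffs (\<lambda>m. if m = 0 then qone else 0) a = a"
    by (simp add: fun_eq_iff)
qed

text \<open>The recursion adds factors on the left; right contraction needs the new factor on the
  right.\<close>

lemma star_pow_coeffs_Suc_right:
  "star_pow_coeffs b (Suc n) = star_coeffs (star_pow_coeffs b n) b"
proof (induction n)
  case 0
  show ?case by (simp add: star_coeffs_one)
next
  case (Suc n)
  have "star_pow_coeffs b (Suc (Suc n)) = star_coeffs b (star_coeffs (star_pow_coeffs b n) b)"
    by (simp flip: Suc)
  then show ?case by (simp add: star_coeffs_assoc)
qed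

text \<open>Conjugating coefficients reverses *-products; this is the device that exchanges the two
  sides.\<close>

lemma star_coeffs_qcnj:
  "qcnj (star_coeffs a b n) = star_coeffs (\<lambda>m. qcnj (b m)) (\<lambda>m. qcnj (a m)) n"
  unfolding star_coeffs_def qcnj_sum qcnj_qmult
  by (rule sum.reindex_bij_witness[of _ "\<lambda>m. n - m" "\<lambda>m. n - m"]) auto

lemma star_pow_coeffs_qcnj:
  "qcnj (star_pow_coeffs b n m) = star_pow_coeffs (\<lambda>m. qcnj (b m)) n m"
proof (induction n arbitrary: m)
  case 0
  show ?case by (simp add: qone_def qcnj_def zero_prod_def)
next
  case (Suc n)
  then show ?case
    unfolding star_pow_coeffs_Suc_right[of b] star_coeffs_qcnj by simp
qed

text \<open>A zero of order at least 1 at the origin becomes one of order at least n in the n-th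
  power.\<close>

lemma star_pow_coeffs_eq_0:
  assumes "b 0 = 0" "m < n"
  shows "star_pow_coeffs b n m = 0"
  using assms(2)
proof (induction n arbitrary: m)
  case (Suc n)
  have "qmult (b k) (star_pow_coeffs b n (m - k)) = 0" if "k \<le> m" for k
  proof (cases "k = 0")
    case True
    then show ?thesis by (simp add: assms(1) qmult.zero_left)
  next
    case False
    with that Suc.prems have "m - k < n" by linarith
    then show ?thesis by (simp add: Suc.IH qmult.zero_right)
  qed
  then show ?case by (simp add: star_coeffs_def)
qed simp

text \<open>The n-th power arises from the constant 1, of norm 1, by n contractions. The uniform
  bound later justifies exchanging the sums.\<close>

lemma norm_star_pow_coeffs_le:
  assumes contr: "\<And>x N. (\<Sum>n\<le>N. (norm (star_coeffs x b n))\<^sup>2) \<le> (\<Sum>n\<le>N. (norm (x n))\<^sup>2)"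
  shows "norm (star_pow_coeffs b n m) \<le> 1"
proof -
  have "(\<Sum>k\<le>m. (norm (star_pow_coeffs b n k))\<^sup>2) \<le> 1"
  proof (induction n)
    case 0
    have "(norm (if k = 0 then qone else 0))\<^sup>2 = (if k = 0 then 1 else 0)" for k :: nat
      by simp
    then show ?case by simp
  next
    case (Suc n)
    then show ?case
      unfolding star_pow_coeffs_Suc_right using contr order_trans by blast
  qed
  moreover have "(norm (star_pow_coeffs b n m))\<^sup>2 \<le> (\<Sum>k\<le>m. (norm (star_pow_coeffs b n k))\<^sup>2)"
    by (rule member_le_sum) auto
  ultimately have "(norm (star_pow_coeffs b n m))\<^sup>2 \<le> 1"
    by (rule order_trans[rotated])
  then show ?thesis by (simp add: abs_square_le_1)
qed

text \<open>The coefficient at \<open>0\<close> splits off because \<open>b\<close> has none; the remaining ones are those of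
  \<open>x * b\<close>, where \<open>x\<close> belongs to the backward shift of \<open>a\<close>.\<close>

lemma littlewood_coeffs:
  assumes b: "b 0 = 0"
    and contr: "\<And>x N. (\<Sum>n\<le>N. (norm (star_coeffs x b n))\<^sup>2) \<le> (\<Sum>n\<le>N. (norm (x n))\<^sup>2)"
  shows "(\<Sum>m\<le>N. (norm (\<Sum>n\<le>m. qmult (a n) (star_pow_coeffs b n m)))\<^sup>2) \<le> (\<Sum>n\<le>N. (norm (a n))\<^sup>2)"
proof (induction N arbitrary: a)
  case 0
  show ?case by simp
next
  case (Suc N)
  define c where "c m = (\<Sum>n\<le>m. qmult (a n) (star_pow_coeffs b n m))" for m
  \<comment> \<open>The cut at \<open>N\<close> removes the term \<open>x (Suc N)\<close>, so that
    contraction at \<open>Suc N\<close> lands on a sum up to \<open>N\<close>, to which the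
    induction hypothesis for the shifted sequence applies.\<close>
  define x where "x k = (if k \<le> N then \<Sum>n\<le>k. qmult (a (Suc n)) (star_pow_coeffs b n k) else 0)" for k
  have c_Suc: "c (Suc m) = star_coeffs x b (Suc m)" if "m \<le> N" for m
  proof -
    have "c (Suc m) = (\<Sum>n\<le>m. qmult (a (Suc n)) (star_pow_coeffs b (Suc n) (Suc m)))"
      by (simp only: c_def sum.atMost_Suc_shift) (simp add: qmult.zero_right)
    also have "\<dots> = (\<Sum>n\<le>m. \<Sum>k\<le>m. qmult (a (Suc n)) (qmult (star_pow_coeffs b n k) (b (Suc m - k))))"
      unfolding star_pow_coeffs_Suc_right star_coeffs_def
      by (simp add: b qmult.zero_right qmult.sum_right)
    also have "\<dots> = (\<Sum>k\<le>m. \<Sum>n\<le>m. qmult (a (Suc n)) (qmult (star_pow_coeffs b n k) (b (Suc m - k))))"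
      by (rule sum.swap)
    \<comment> \<open>Degree \<open>k\<close> sees only powers with n \<le> k, so the inner sum is
      exactly \<open>x k\<close> times the coefficient of \<open>b\<close>.\<close>
    also have "\<dots> = (\<Sum>k\<le>m. \<Sum>n\<le>k. qmult (a (Suc n)) (qmult (star_pow_coeffs b n k) (b (Suc m - k))))"
      by (intro sum.cong refl sum.mono_neutral_right)
        (auto simp: star_pow_coeffs_eq_0[of b, OF b] qmult.zero_left qmult.zero_right)
    also have "\<dots> = (\<Sum>k\<le>m. qmult (x k) (b (Suc m - k)))"
      using that by (intro sum.cong refl) (simp add: x_def qmult.sum_left qmult_assoc)
    also have "\<dots> = star_coeffs x b (Suc m)"
      by (simp add: star_coeffs_def b qmult.zero_right)
    finally show ?thesis .
  qed
  have "(\<Sum>m\<le>Suc N. (norm (c m))\<^sup>2) = (norm (a 0))\<^sup>2 + (\<Sum>m\<le>N. (norm (star_coeffs x b (Suc m)))\<^sup>2)"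
    unfolding sum.atMost_Suc_shift by (simp add: c_Suc) (simp add: c_def)
  also have "(\<Sum>m\<le>N. (norm (star_coeffs x b (Suc m)))\<^sup>2) \<le> (\<Sum>m\<le>Suc N. (norm (star_coeffs x b m))\<^sup>2)"
    unfolding sum.atMost_Suc_shift by simp
  also have "\<dots> \<le> (\<Sum>m\<le>Suc N. (norm (x m))\<^sup>2)"
    by (rule contr)
  also have "\<dots> = (\<Sum>m\<le>N. (norm (\<Sum>n\<le>m. qmult (a (Suc n)) (star_pow_coeffs b n m)))\<^sup>2)"
    by (simp add: x_def)
  also have "\<dots> \<le> (\<Sum>n\<le>N. (norm (a (Suc n)))\<^sup>2)"
    by (rule Suc.IH)
  also have "(norm (a 0))\<^sup>2 + \<dots> = (\<Sum>n\<le>Suc N. (norm (a n))\<^sup>2)"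
    unfolding sum.atMost_Suc_shift by simp
  finally show ?case by (simp add: c_def)
qed

text \<open>Conjugation turns left contraction by \<open>b\<close> into right contraction by the
  conjugate sequence and places \<open>a n\<close> on the left, which is the situation of
  \<open>littlewood_coeffs\<close>.\<close>

lemma littlewood_coeffs_left:
  assumes b: "b 0 = 0"
    and contr: "\<And>x N. (\<Sum>n\<le>N. (norm (star_coeffs b x n))\<^sup>2) \<le> (\<Sum>n\<le>N. (norm (x n))\<^sup>2)"
  shows "(\<Sum>m\<le>N. (norm (\<Sum>n\<le>m. qmult (star_pow_coeffs b n m) (a n)))\<^sup>2) \<le> (\<Sum>n\<le>N. (norm (a n))\<^sup>2)"
proof -
  let ?b = "\<lambda>m. qcnj (b m)"
  have contr': "(\<Sum>n\<le>N. (norm (star_coeffs x ?b n))\<^sup>2) \<le> (\<Sum>n\<le>N. (norm (x n))\<^sup>2)" for x N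
  proof -
    have "norm (star_coeffs x ?b n) = norm (star_coeffs b (\<lambda>m. qcnj (x m)) n)" for n
      using star_coeffs_qcnj[of b "\<lambda>m. qcnj (x m)" n] by (metis (no_types, lifting) norm_qcnj qcnj_qcnj ext)
    then show ?thesis using contr[where x = "\<lambda>m. qcnj (x m)" and N = N] by simp
  qed
  have "norm (\<Sum>n\<le>m. qmult (star_pow_coeffs b n m) (a n)) =
      norm (\<Sum>n\<le>m. qmult (qcnj (a n)) (star_pow_coeffs ?b n m))" for m
    by (subst norm_qcnj[symmetric]) (simp add: qcnj_sum qcnj_qmult star_pow_coeffs_qcnj)
  then show ?thesis
    using littlewood_coeffs[of ?b "\<lambda>n. qcnj (a n)" N, OF _ contr'] b by simp
qed

text \<open>Absolute summability over the triangle n \<le> m allows summation in either order: by m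
  it gives the power series, by n the sum defining a composition.\<close>

lemma triangular_double_series:
  assumes q: "q \<in> ball 0 1" and bound: "\<And>n m. norm (t n m) \<le> A"
    and tri: "\<And>n m. m < n \<Longrightarrow> t n m = 0"
  shows "(\<lambda>m. qmult (qpow q m) (\<Sum>n\<le>m. t n m)) sums (\<Sum>n. \<Sum>m. qmult (qpow q m) (t n m))"
proof -
  define g where "g n m = qmult (qpow q m) (t n m)" for n m
  have "A \<ge> 0" using bound[of 0 0] norm_ge_zero order_trans by blast
  have g_le: "norm (g n m) \<le> A * norm q ^ m" for n m
    using mult_right_mono[OF bound, of "norm q ^ m" n m]
    by (simp add: g_def norm_qmult mult.commute)
  have "(\<lambda>(m, n). norm (g n m)) summable_on Sigma UNIV (\<lambda>m. {..m})"
  proof (rule summable_on_SigmaI)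
    show "((\<lambda>n. (\<lambda>(m, n). norm (g n m)) (m, n)) has_sum (\<Sum>n\<le>m. norm (g n m))) {..m}" for m
      using has_sum_finite[of "{..m}" "\<lambda>n. norm (g n m)"] by simp
    \<comment> \<open>Degree m contributes m + 1 terms of size at most A |q|^m; the majorant is a
      differentiated geometric series.\<close>
    have "summable (\<lambda>m. A * (of_nat (Suc m) * norm q ^ m))"
      using geometric_deriv_sums[of "norm q"] q by (intro summable_mult) (auto simp: sums_iff)
    then have "summable (\<lambda>m. \<Sum>n\<le>m. norm (g n m))"
    proof (rule summable_comparison_test')
      fix m
      have "(\<Sum>n\<le>m. norm (g n m)) \<le> (\<Sum>n\<le>m. A * norm q ^ m)"
        by (intro sum_mono g_le)
      then show "norm (\<Sum>n\<le>m. norm (g n m)) \<le> A * (of_nat (Suc m) * norm q ^ m)"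
        by (simp add: sum_nonneg algebra_simps)
    qed
    then show "(\<lambda>m. \<Sum>n\<le>m. norm (g n m)) summable_on UNIV"
      by (subst summable_on_UNIV_nonneg_real_iff) (auto simp: sum_nonneg)
  qed auto
  then have "(\<lambda>(m, n). g n m) summable_on Sigma UNIV (\<lambda>m. {..m})"
    by - (rule abs_summable_summable, simp add: case_prod_unfold)
  then obtain S where S: "((\<lambda>(m, n). g n m) has_sum S) (Sigma UNIV (\<lambda>m. {..m}))"
    by (auto simp: summable_on_def)
  have "((\<lambda>m. \<Sum>n\<le>m. g n m) has_sum S) UNIV"
  proof (rule has_sum_SigmaD[OF S])
    show "((\<lambda>n. (\<lambda>(m, n). g n m) (m, n)) has_sum (\<Sum>n\<le>m. g n m)) {..m}" for m
      using has_sum_finite[of "{..m}" "\<lambda>n. g n m"] by simp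
  qed
  then have 1: "(\<lambda>m. \<Sum>n\<le>m. g n m) sums S"
    by (rule has_sum_imp_sums)
  have "bij_betw (\<lambda>(n, m). (m, n)) (Sigma UNIV (\<lambda>n. {n..})) (Sigma UNIV (\<lambda>m. {..m}))"
    by (rule bij_betwI[of _ _ _ "\<lambda>(m, n). (n, m)"]) auto
  from has_sum_reindex_bij_betw[OF this, of "\<lambda>(m, n). g n m" S] S
  have S': "((\<lambda>(n, m). g n m) has_sum S) (Sigma UNIV (\<lambda>n. {n..}))"
    by (simp add: case_prod_unfold)
  have "((\<lambda>n. \<Sum>m. g n m) has_sum S) UNIV"
  proof (rule has_sum_SigmaD[OF S'])
    fix n
    have "summable (\<lambda>m. norm (g n m))"
      by (rule summable_comparison_test'[of "\<lambda>m. A * norm q ^ m"])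
        (use q g_le in \<open>auto intro!: summable_mult summable_geometric\<close>)
    from norm_summable_imp_has_sum[OF this summable_sums[OF summable_norm_cancel[OF this]]]
    have "((\<lambda>m. g n m) has_sum (\<Sum>m. g n m)) UNIV" .
    \<comment> \<open>Entries outside the triangle vanish, so the sum over \<open>{n..}\<close> is
      the full series.\<close>
    moreover have "g n m = 0" if "m < n" for m
      by (simp add: g_def tri[OF that] qmult.zero_right)
    ultimately show "((\<lambda>m. (\<lambda>(n, m). g n m) (n, m)) has_sum (\<Sum>m. g n m)) {n..}"
      by (subst has_sum_cong_neutral[of UNIV "{n..}"]) (auto simp: not_le)
  qed
  then have "(\<lambda>n. \<Sum>m. g n m) sums S"
    by (rule has_sum_imp_sums)
  then have "S = (\<Sum>n. \<Sum>m. g n m)" by (rule sums_unique)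
  with 1 show ?thesis by (simp add: g_def qmult.sum_right)
qed

lemma has_qseries_qcoeffs:
  assumes "slice_regular (ball 0 1) f"
  shows "has_qseries f (qcoeffs f)"
  using someI_ex[OF slice_regular_expansion[OF assms]]
  by (simp add: qcoeffs_def has_qseries_def)

lemma has_qseries_at_0:
  assumes "has_qseries f a"
  shows "f 0 = a 0"
proof -
  have "(\<lambda>n. qmult (qpow 0 n) (a n)) sums f 0"
    using has_qseriesD[OF assms, of 0] by simp
  moreover have "(\<lambda>n. qmult (qpow 0 n) (a n)) sums (\<Sum>n\<in>{0}. qmult (qpow 0 n) (a n))"
  proof (rule sums_finite)
    fix n :: nat assume "n \<notin> {0}"
    then show "qmult (qpow 0 n) (a n) = 0"
      by (cases n) (simp_all add: qmult.zero_left)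
  qed simp
  ultimately show ?thesis
    using sums_unique2 by fastforce
qed

theorem theorem6p1:
  fixes \<phi> f :: "quat \<Rightarrow> quat"
  assumes "slice_regular (ball 0 1) \<phi>"
    and "\<phi> ` ball 0 1 \<subseteq> ball 0 1"
    and "\<phi> 0 = 0"
    and "f \<in> H2"
  shows "comp_up f \<phi> \<in> H2 \<and> comp_low f \<phi> \<in> H2
       \<and> hardy_norm 2 (comp_up f \<phi>) \<le> hardy_norm 2 f
       \<and> hardy_norm 2 (comp_low f \<phi>) \<le> hardy_norm 2 f"
proof -
  define a where "a = qcoeffs f"
  define b where "b = qcoeffs \<phi>"
  define \<beta> where "\<beta> = star_pow_coeffs b"
  have \<phi>: "has_qseries \<phi> b"
    using has_qseries_qcoeffs[OF assms(1)] by (simp add: b_def)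
  have f: "has_qseries f a" and f_fin: "hardy_norm 2 f < \<infinity>"
    using has_qseries_qcoeffs[of f] assms(4) by (auto simp: a_def H2_def)
  have b0: "b 0 = 0"
    using has_qseries_at_0[OF \<phi>] assms(3) by simp
  have right: "(\<Sum>n\<le>N. (norm (star_coeffs x b n))\<^sup>2) \<le> (\<Sum>n\<le>N. (norm (x n))\<^sup>2)" for x N
    by (rule star_right_contraction[OF \<phi> assms(2)])
  have left: "(\<Sum>n\<le>N. (norm (star_coeffs b x n))\<^sup>2) \<le> (\<Sum>n\<le>N. (norm (x n))\<^sup>2)" for x N
    by (rule star_left_contraction[OF right])
  have \<beta>_le: "norm (\<beta> n m) \<le> 1" for n m
    unfolding \<beta>_def by (rule norm_star_pow_coeffs_le[OF right])
  have \<beta>_0: "\<beta> n m = 0" if "m < n" for n m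
    unfolding \<beta>_def by (rule star_pow_coeffs_eq_0[of b, OF b0 that])

  have norm_f: "hardy_norm 2 f = (SUP N. ereal (sqrt (\<Sum>n\<le>N. (norm (a n))\<^sup>2)))"
    by (rule hardy_norm_2_eq[OF f])
  \<comment> \<open>One coefficient is a partial sum's share of the norm; finiteness of the norm
    thus yields the uniform bound \<open>A\<close>.\<close>
  have "ereal (norm (a n)) \<le> hardy_norm 2 f" for n
  proof -
    have "(norm (a n))\<^sup>2 \<le> (\<Sum>k\<le>n. (norm (a k))\<^sup>2)"
      by (rule member_le_sum) auto
    then have "norm (a n) \<le> sqrt (\<Sum>k\<le>n. (norm (a k))\<^sup>2)"
      by (rule real_le_rsqrt)
    then show ?thesis
      unfolding norm_f by (intro SUP_upper2[of n]) auto
  qed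
  then have "\<exists>A. \<forall>n. norm (a n) \<le> A"
    using f_fin by (cases "hardy_norm 2 f") auto
  then obtain A where A: "\<And>n. norm (a n) \<le> A" by blast

  \<comment> \<open>Needed to move the right factor \<open>a n\<close> inside the series of
    \<phi>^{*n} in \<open>comp_up\<close>; in \<open>comp_low\<close> the factor is inside by
    definition.\<close>
  have summable_\<beta>: "summable (\<lambda>m. qmult (qpow q m) (\<beta> n m))" if "q \<in> ball 0 1" for q n
  proof (rule summable_comparison_test'[of "\<lambda>m. norm q ^ m"])
    show "summable (\<lambda>m. norm q ^ m)"
      using that by (intro summable_geometric) simp
    show "norm (qmult (qpow q m) (\<beta> n m)) \<le> norm q ^ m" for m
      using \<beta>_le[of n m] by (simp add: norm_qmult mult_left_le)
  qed

  \<comment> \<open>Common end of both cases: \<open>t n m\<close> is the coefficient of q^m in the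
    n-th summand of the composition.\<close>
  have conclude: "g \<in> H2 \<and> hardy_norm 2 g \<le> hardy_norm 2 f"
    if t_le: "\<And>n m. norm (t n m) \<le> A" and t_0: "\<And>n m. m < n \<Longrightarrow> t n m = 0"
      and g: "\<And>q. q \<in> ball 0 1 \<Longrightarrow> g q = (\<Sum>n. \<Sum>m. qmult (qpow q m) (t n m))"
      and contr: "\<And>N. (\<Sum>m\<le>N. (norm (\<Sum>n\<le>m. t n m))\<^sup>2) \<le> (\<Sum>n\<le>N. (norm (a n))\<^sup>2)" for t g
  proof -
    have gs: "has_qseries g (\<lambda>m. \<Sum>n\<le>m. t n m)"
      unfolding has_qseries_def
    proof
      fix q :: quat assume q: "q \<in> ball 0 1"
      show "(\<lambda>m. qmult (qpow q m) (\<Sum>n\<le>m. t n m)) sums g q"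
        unfolding g[OF q] by (rule triangular_double_series[OF q t_le t_0])
    qed
    have "hardy_norm 2 g \<le> hardy_norm 2 f"
      unfolding hardy_norm_2_eq[OF gs] norm_f
      by (intro SUP_mono bexI[of _ "N" for N]) (auto intro: contr)
    then show ?thesis
      using has_qseries_slice_regular[OF gs] f_fin by (auto simp: H2_def)
  qed

  have "comp_up f \<phi> \<in> H2 \<and> hardy_norm 2 (comp_up f \<phi>) \<le> hardy_norm 2 f"
  proof (rule conclude)
    show "norm (qmult (\<beta> n m) (a n)) \<le> A" for n m
      using mult_mono[OF \<beta>_le[of n m] A[of n]] by (simp add: norm_qmult)
    show "qmult (\<beta> n m) (a n) = 0" if "m < n" for n m
      by (simp add: \<beta>_0[OF that] qmult.zero_left)
    show "comp_up f \<phi> q = (\<Sum>n. \<Sum>m. qmult (qpow q m) (qmult (\<beta> n m) (a n)))" if "q \<in> ball 0 1" for q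
      unfolding comp_up_def star_pow_def pseries_def
      unfolding a_def[symmetric] b_def[symmetric] \<beta>_def[symmetric]
        bounded_linear.suminf[OF qmult.bounded_linear_left summable_\<beta>[OF that]] qmult_assoc ..
    show "(\<Sum>m\<le>N. (norm (\<Sum>n\<le>m. qmult (\<beta> n m) (a n)))\<^sup>2) \<le> (\<Sum>n\<le>N. (norm (a n))\<^sup>2)" for N
      unfolding \<beta>_def by (rule littlewood_coeffs_left[OF b0 left])
  qed
  moreover have "comp_low f \<phi> \<in> H2 \<and> hardy_norm 2 (comp_low f \<phi>) \<le> hardy_norm 2 f"
  proof (rule conclude)
    show "norm (qmult (a n) (\<beta> n m)) \<le> A" for n m
      using mult_mono[OF A[of n] \<beta>_le[of n m]] norm_ge_zero[of "a n"] A[of n] by (simp add: norm_qmult)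
    show "qmult (a n) (\<beta> n m) = 0" if "m < n" for n m
      by (simp add: \<beta>_0[OF that] qmult.zero_right)
    show "comp_low f \<phi> q = (\<Sum>n. \<Sum>m. qmult (qpow q m) (qmult (a n) (\<beta> n m)))" if "q \<in> ball 0 1" for q
      by (simp add: comp_low_def pseries_def a_def b_def \<beta>_def)
    show "(\<Sum>m\<le>N. (norm (\<Sum>n\<le>m. qmult (a n) (\<beta> n m)))\<^sup>2) \<le> (\<Sum>n\<le>N. (norm (a n))\<^sup>2)" for N
      unfolding \<beta>_def by (rule littlewood_coeffs[OF b0 right])
  qed
  ultimately show ?thesis by blast
qed

end
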